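(* Let $G$ be a Garside group with a fixed Garside element $\Delta$, let $g\in G$ and let $n\geqslant 1$ be an integer. Then $g$ has an $n$th root in $G$ if and only if the ultra summit set of $\delta(g,1,\ldots,1)\in G(n)$ contains an element of the form $\delta(h,\ldots,h)$ with $h\in G$. In this case, if $\delta(g,1,\ldots,1)=\gamma^{-1}\,\delta(h,\ldots,h)\,\gamma$ for some $\gamma=\delta^k(x_1,\ldots,x_n)\in G(n)$, then $g=(x_n^{-1}hx_n)^n$.
   Context: Garside monoids and groups. Let $M$ be a monoid. An atom of $M$ is an element $a\neq 1$ such that $a=bc$ with $b,c\in M$ implies $b=1$ or $c=1$. For $a\in M$ let $\|a\|$ be the supremum of the lengths of all expressions of $a$ as a product of atoms. $M$ is atomic if it is generated by its atoms and $\|a\|<\infty$ for all $a\in M$. In an atomic monoid: $a\leqslant_L b$ if $ac=b$ for some $c\in M$, and $a\leqslant_R b$ if $ca=b$ for some $c\in M$; $L(a)=\{b: b\leqslant_L a\}$, $R(a)=\{b: b\leqslant_R a\}$. An atomic monoid $M$ is a Garside monoid if it is finitely generated, left and right cancellative, $(M,\leqslant_L)$ and $(M,\leqslant_R)$ are lattices, and there is an element $\Delta\in M$ (a Garside element) such that $L(\Delta)=R(\Delta)$ and this set generates $M$; the elements of $\mathcal D=L(\Delta)$ are the simple elements. A Garside monoid embeds in its group of fractions; a Garside group $G$ is the group of fractions of a Garside monoid, denoted $G^+$. The order extends to $G$: $g\leqslant_L h$ if $gc=h$ for some $c\in G^+$. $\wedge_L$ denotes the gcd for $\leqslant_L$,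 and $\tau(g)=\Delta^{-1}g\Delta$. Invariants, normal form, cycling. For $g\in G$, $\inf(g)=\max\{r\in\mathbb Z:\Delta^r\leqslant_L g\}$, $\sup(g)=\min\{s\in\mathbb Z: g\leqslant_L\Delta^s\}$. With $[g]$ the conjugacy class, $\inf_s(g)=\max\{\inf(h):h\in[g]\}$, $\sup_s(g)=\min\{\sup(h):h\in[g]\}$. The super summit set is $[g]^S=\{h\in[g]:\inf(h)=\inf_s(g),\ \sup(h)=\sup_s(g)\}$. Each $g\in G$ has a unique normal form $g=\Delta^r s_1\cdots s_k$ with $s_i\in\mathcal D\setminus\{1,\Delta\}$ and $(s_i s_{i+1}\cdots s_k)\wedge_L\Delta=s_i$ for all $i$; the cycling of $g$ is $\mathbf c(g)=\Delta^r s_2\cdots s_k\,\tau^{-r}(s_1)$ (and $\mathbf c(g)=g$ if $k=0$). The ultra summit set is $[g]^U=\{h\in[g]^S: \mathbf c^k(h)=h\text{ for some }k>0\}$. The group $G(n)$. $G(n)=\mathbb Z\ltimes G^n$, where $\mathbb Z=\langle\delta\rangle$ acts on the right on the cartesian product $G^n$ by $(g_1,\ldots,g_n)^\delta=(g_n,g_1,\ldots,g_{n-1})$. Its elements are written $\delta^k(g_1,\ldots,g_n)$, with product $\delta^k u\cdot\delta^l v=\delta^{k+l}\,u^{\delta^l}v$ for $u,v\in G^n$. $G(n)$ is a Garside group with positive monoid $\{\delta^k(a_1,\ldots,a_n): k\geqslant 0,\ a_i\in G^+\}$ and Garside element $\delta(\Delta,\ldots,\Delta)$, and all notions above in $G(n)$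 are taken with respect to this Garside element. *)

theory Defs
  imports
    "HOL-Algebra.Lattice"
    "HOL-Algebra.Divisibility"
    "HOL-Algebra.Product_Groups"
    "HOL-Library.Extended_Nat"
begin

section \<open>Garside monoids\<close>

definition list_prod :: "('a, 'b) monoid_scheme \<Rightarrow> 'a list \<Rightarrow> 'a" where
  "list_prod M xs = foldr (mult M) xs \<one>\<^bsub>M\<^esub>"

definition monoid_generated :: "('a, 'b) monoid_scheme \<Rightarrow> 'a set \<Rightarrow> 'a set" where
  "monoid_generated M S = {list_prod M xs | xs. set xs \<subseteq> S}"

definition atoms :: "('a, 'b) monoid_scheme \<Rightarrow> 'a set" where
  "atoms M = {a \<in> carrier M. a \<noteq> \<one>\<^bsub>M\<^esub> \<and>
     (\<forall>b \<in> carrier M. \<forall>c \<in> carrier M. a = b \<otimes>\<^bsub>M\<^esub> c \<longrightarrow> b = \<one>\<^bsub>M\<^esub> \<or> c = \<one>\<^bsub>M\<^esub>)}"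

definition atom_norm :: "('a, 'b) monoid_scheme \<Rightarrow> 'a \<Rightarrow> enat" where
  "atom_norm M a = Sup {enat (length xs) | xs. set xs \<subseteq> atoms M \<and> list_prod M xs = a}"

locale atomic_monoid = monoid M for M (structure) +
  assumes atoms_generate: "monoid_generated M (atoms M) = carrier M"
    and norm_finite: "a \<in> carrier M \<Longrightarrow> atom_norm M a < \<infinity>"

text \<open>
  The orders are defined relative to a submonoid \<open>P\<close> of \<open>G\<close>. The divisibility orders of a
  monoid \<open>M\<close> are the case \<open>P = carrier M\<close>; their extension to a group of fractions \<open>G\<close> of
  a Garside monoid is the case where \<open>P\<close> is the positive monoid inside \<open>G\<close>.
\<close>

definition le_left :: "('a, 'b) monoid_scheme \<Rightarrow> 'a set \<Rightarrow> 'a \<Rightarrow> 'a \<Rightarrow> bool" where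
  "le_left G P g h \<longleftrightarrow> (\<exists>c \<in> P. g \<otimes>\<^bsub>G\<^esub> c = h)"

definition le_right :: "('a, 'b) monoid_scheme \<Rightarrow> 'a set \<Rightarrow> 'a \<Rightarrow> 'a \<Rightarrow> bool" where
  "le_right G P g h \<longleftrightarrow> (\<exists>c \<in> P. c \<otimes>\<^bsub>G\<^esub> g = h)"

definition left_order :: "('a, 'b) monoid_scheme \<Rightarrow> 'a set \<Rightarrow> 'a gorder" where
  "left_order G P = \<lparr>carrier = carrier G, eq = (=), le = le_left G P\<rparr>"

definition right_order :: "('a, 'b) monoid_scheme \<Rightarrow> 'a set \<Rightarrow> 'a gorder" where
  "right_order G P = \<lparr>carrier = carrier G, eq = (=), le = le_right G P\<rparr>"

definition left_divisors :: "('a, 'b) monoid_scheme \<Rightarrow> 'a set \<Rightarrow> 'a \<Rightarrow> 'a set" where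
  "left_divisors G P a = {b \<in> P. le_left G P b a}"

definition right_divisors :: "('a, 'b) monoid_scheme \<Rightarrow> 'a set \<Rightarrow> 'a \<Rightarrow> 'a set" where
  "right_divisors G P a = {b \<in> P. le_right G P b a}"

locale garside_monoid = atomic_monoid M + monoid_cancel M for M (structure) +
  fixes \<Delta> :: 'a
  assumes finitely_generated:
      "\<exists>S. finite S \<and> S \<subseteq> carrier M \<and> monoid_generated M S = carrier M"
    and left_lattice: "lattice (left_order M (carrier M))"
    and right_lattice: "lattice (right_order M (carrier M))"
    and Delta_closed: "\<Delta> \<in> carrier M"
    and Delta_balanced: "left_divisors M (carrier M) \<Delta> = right_divisors M (carrier M) \<Delta>"
    and Delta_generates: "monoid_generated M (left_divisors M (carrier M) \<Delta>) = carrier M"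


section \<open>Garside groups\<close>

text \<open>
  A Garside group is given together with its positive monoid \<open>P\<close> and its Garside element.
  That \<open>G\<close> is the group of fractions of \<open>P\<close> is expressed by \<open>P\<close> being a submonoid of \<open>G\<close>
  such that every element of \<open>G\<close> is a fraction of elements of \<open>P\<close>.
\<close>

locale garside_group = group G for G (structure) +
  fixes P :: "'a set" and \<Delta> :: 'a
  assumes positive_submonoid: "submonoid P G"
    and positive_garside: "garside_monoid (G\<lparr>carrier := P\<rparr>) \<Delta>"
    and fractions: "carrier G = {inv a \<otimes> b | a b. a \<in> P \<and> b \<in> P}"

definition garside_inf :: "('a, 'b) monoid_scheme \<Rightarrow> 'a set \<Rightarrow> 'a \<Rightarrow> 'a \<Rightarrow> int" where
  "garside_inf G P \<Delta> g = (GREATEST r::int. le_left G P (\<Delta> [^]\<^bsub>G\<^esub> r) g)"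

definition garside_sup :: "('a, 'b) monoid_scheme \<Rightarrow> 'a set \<Rightarrow> 'a \<Rightarrow> 'a \<Rightarrow> int" where
  "garside_sup G P \<Delta> g = (LEAST s::int. le_left G P g (\<Delta> [^]\<^bsub>G\<^esub> s))"

definition conj_class :: "('a, 'b) monoid_scheme \<Rightarrow> 'a \<Rightarrow> 'a set" where
  "conj_class G g = {inv\<^bsub>G\<^esub> x \<otimes>\<^bsub>G\<^esub> g \<otimes>\<^bsub>G\<^esub> x | x. x \<in> carrier G}"

definition summit_inf :: "('a, 'b) monoid_scheme \<Rightarrow> 'a set \<Rightarrow> 'a \<Rightarrow> 'a \<Rightarrow> int" where
  "summit_inf G P \<Delta> g = (GREATEST r. r \<in> garside_inf G P \<Delta> ` conj_class G g)"

definition summit_sup :: "('a, 'b) monoid_scheme \<Rightarrow> 'a set \<Rightarrow> 'a \<Rightarrow> 'a \<Rightarrow> int" where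
  "summit_sup G P \<Delta> g = (LEAST s. s \<in> garside_sup G P \<Delta> ` conj_class G g)"

definition super_summit_set :: "('a, 'b) monoid_scheme \<Rightarrow> 'a set \<Rightarrow> 'a \<Rightarrow> 'a \<Rightarrow> 'a set" where
  "super_summit_set G P \<Delta> g = {h \<in> conj_class G g.
     garside_inf G P \<Delta> h = summit_inf G P \<Delta> g \<and> garside_sup G P \<Delta> h = summit_sup G P \<Delta> g}"

definition is_normal_form ::
    "('a, 'b) monoid_scheme \<Rightarrow> 'a set \<Rightarrow> 'a \<Rightarrow> 'a \<Rightarrow> int \<Rightarrow> 'a list \<Rightarrow> bool" where
  "is_normal_form G P \<Delta> g r ss \<longleftrightarrow>
     g = \<Delta> [^]\<^bsub>G\<^esub> r \<otimes>\<^bsub>G\<^esub> list_prod G ss \<and>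
     set ss \<subseteq> left_divisors G P \<Delta> - {\<one>\<^bsub>G\<^esub>, \<Delta>} \<and>
     (\<forall>i < length ss. list_prod G (drop i ss) \<sqinter>\<^bsub>left_order G P\<^esub> \<Delta> = ss ! i)"

text \<open>The integer power \<open>\<tau>\<^sup>k\<close> of \<open>\<tau>(g) = \<Delta>\<^sup>-\<^sup>1 g \<Delta>\<close>.\<close>

definition tau_pow :: "('a, 'b) monoid_scheme \<Rightarrow> 'a \<Rightarrow> int \<Rightarrow> 'a \<Rightarrow> 'a" where
  "tau_pow G \<Delta> k g = \<Delta> [^]\<^bsub>G\<^esub> (- k) \<otimes>\<^bsub>G\<^esub> g \<otimes>\<^bsub>G\<^esub> \<Delta> [^]\<^bsub>G\<^esub> k"

definition cycling :: "('a, 'b) monoid_scheme \<Rightarrow> 'a set \<Rightarrow> 'a \<Rightarrow> 'a \<Rightarrow> 'a" where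
  "cycling G P \<Delta> g =
     (case (THE (r, ss). is_normal_form G P \<Delta> g r ss) of
        (r, []) \<Rightarrow> g
      | (r, s # ts) \<Rightarrow> \<Delta> [^]\<^bsub>G\<^esub> r \<otimes>\<^bsub>G\<^esub> list_prod G ts \<otimes>\<^bsub>G\<^esub> tau_pow G \<Delta> (- r) s)"

definition ultra_summit_set :: "('a, 'b) monoid_scheme \<Rightarrow> 'a set \<Rightarrow> 'a \<Rightarrow> 'a \<Rightarrow> 'a set" where
  "ultra_summit_set G P \<Delta> g =
     {h \<in> super_summit_set G P \<Delta> g. \<exists>k>0. (cycling G P \<Delta> ^^ k) h = h}"


section \<open>The group \<open>G(n)\<close>\<close>

text \<open>
  Tuples \<open>(u\<^sub>1, \<dots>, u\<^sub>n)\<close> are extensional functions on \<open>{1..n}\<close>, and \<open>(k, u)\<close> stands for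
  \<open>\<delta>\<^sup>k u\<close>. The entry of \<open>u\<^bsup>\<delta>\<^sup>l\<^esup>\<close> at \<open>i\<close> is the entry of \<open>u\<close> at \<open>i - l\<close>, read modulo \<open>n\<close>
  in \<open>{1..n}\<close>; the lemmas below check that this is the power action of the
  generator \<open>\<delta>\<close>.
\<close>

definition shift :: "nat \<Rightarrow> int \<Rightarrow> (nat \<Rightarrow> 'a) \<Rightarrow> nat \<Rightarrow> 'a" where
  "shift n l u = (\<lambda>i \<in> {1..n}. u (nat ((int i - 1 - l) mod int n) + 1))"

lemma shift_one: "shift n 1 u = (\<lambda>i \<in> {1..n}. if i = 1 then u n else u (i - 1))"
proof
  fix i
  have 1: "nat ((- 1) mod int n) + 1 = n" if "1 \<le> n"
    using that by (simp add: zmod_minus1)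
  have 2: "nat ((int i - 2) mod int n) + 1 = i - 1" if "2 \<le> i" "i \<le> n"
    using that by (subst mod_pos_pos_trivial) auto
  show "shift n 1 u i = (\<lambda>i \<in> {1..n}. if i = 1 then u n else u (i - 1)) i"
    using 1 2 by (cases "i = 1") (auto simp: shift_def)
qed

lemma shift_zero: "u \<in> extensional {1..n} \<Longrightarrow> shift n 0 u = u"
proof
  fix i
  assume u: "u \<in> extensional {1..n}"
  have "nat (int i - 1) + 1 = i" if "1 \<le> i"
    using that by simp
  then show "shift n 0 u i = u i"
    using u by (auto simp: shift_def extensional_def simp del: One_nat_def)
qed

lemma shift_index: "1 \<le> n \<Longrightarrow> nat (z mod int n) + 1 \<in> {1..n}"
  using pos_mod_bound[of "int n" z] pos_mod_sign[of "int n" z] by (simp add: nat_less_iff Suc_le_eq)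

lemma shift_shift: "shift n l (shift n k u) = shift n (k + l) u"
proof
  fix i
  show "shift n l (shift n k u) i = shift n (k + l) u i"
  proof (cases "i \<in> {1..n}")
    case True
    then have n: "1 \<le> n" by simp
    have "int (nat ((int i - 1 - l) mod int n) + 1) - 1 - k = (int i - 1 - l) mod int n - k"
      using n by simp
    then have "(int (nat ((int i - 1 - l) mod int n) + 1) - 1 - k) mod int n
        = (int i - 1 - (k + l)) mod int n"
      by (simp add: mod_diff_left_eq algebra_simps)
    then show ?thesis
      using True shift_index[OF n, of "int i - 1 - l"] by (simp add: shift_def)
  qed (auto simp: shift_def)
qed

lemma shift_closed:
  "u \<in> carrier (product_group {1..n} (\<lambda>_. G)) \<Longrightarrow> shift n l u \<in> carrier (product_group {1..n} (\<lambda>_. G))"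
  using shift_index[of n] unfolding shift_def carrier_product_group
  by (intro restrict_PiE_iff[THEN iffD2] ballI) (metis PiE_mem atLeastAtMost_iff le_trans)

lemma shift_mult:
  "shift n l (u \<otimes>\<^bsub>product_group {1..n} (\<lambda>_. G)\<^esub> v)
     = shift n l u \<otimes>\<^bsub>product_group {1..n} (\<lambda>_. G)\<^esub> shift n l v"
proof
  fix i
  show "shift n l (u \<otimes>\<^bsub>product_group {1..n} (\<lambda>_. G)\<^esub> v) i
     = (shift n l u \<otimes>\<^bsub>product_group {1..n} (\<lambda>_. G)\<^esub> shift n l v) i"
    using shift_index[of n "int i - 1 - l"] by (auto simp: shift_def)
qed

definition wreath :: "('a, 'b) monoid_scheme \<Rightarrow> nat \<Rightarrow> (int \<times> (nat \<Rightarrow> 'a)) monoid" where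
  "wreath G n =
     \<lparr>carrier = UNIV \<times> carrier (product_group {1..n} (\<lambda>_. G)),
      mult = (\<lambda>(k, u) (l, v). (k + l, shift n l u \<otimes>\<^bsub>product_group {1..n} (\<lambda>_. G)\<^esub> v)),
      one = (0, \<one>\<^bsub>product_group {1..n} (\<lambda>_. G)\<^esub>)\<rparr>"

definition wreath_pos :: "'a set \<Rightarrow> nat \<Rightarrow> (int \<times> (nat \<Rightarrow> 'a)) set" where
  "wreath_pos P n = {k. 0 \<le> k} \<times> ({1..n} \<rightarrow>\<^sub>E P)"

definition wreath_Delta :: "'a \<Rightarrow> nat \<Rightarrow> int \<times> (nat \<Rightarrow> 'a)" where
  "wreath_Delta \<Delta> n = (1, \<lambda>i \<in> {1..n}. \<Delta>)"

lemma group_wreath: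
  assumes "group G"
  shows "group (wreath G n)"
proof -
  let ?T = "product_group {1..n} (\<lambda>_. G)"
  interpret T: group ?T
    using assms by simp
  have ext: "u \<in> extensional {1..n}" if "u \<in> carrier ?T" for u
    using that by (auto simp: PiE_def)
  have one: "shift n l \<one>\<^bsub>?T\<^esub> = \<one>\<^bsub>?T\<^esub>" for l
    by (metis T.l_cancel_one' T.one_closed T.r_one shift_closed shift_mult)
  show ?thesis
  proof (rule groupI, goal_cases)
    case (3 x y z)
    then show ?case
      by (auto simp: wreath_def shift_mult shift_shift shift_closed T.m_assoc simp del: One_nat_def carrier_product_group mult_product_group)
  next
    case (5 x)
    then obtain k u where x: "x = (k, u)" and u: "u \<in> carrier ?T"
      by (auto simp: wreath_def)
    have "(- k, shift n (- k) (inv\<^bsub>?T\<^esub> u)) \<otimes>\<^bsub>wreath G n\<^esub> x = \<one>\<^bsub>wreath G n\<^esub>"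
      using u x ext[of "inv\<^bsub>?T\<^esub> u"] T.l_inv[OF u] T.inv_closed[OF u]
      by (simp add: wreath_def shift_shift shift_zero del: One_nat_def carrier_product_group mult_product_group one_product_group inv_product_group)
    moreover have "(- k, shift n (- k) (inv\<^bsub>?T\<^esub> u)) \<in> carrier (wreath G n)"
      using shift_closed[OF T.inv_closed[OF u]] by (simp add: wreath_def del: One_nat_def carrier_product_group)
    ultimately show ?case by blast
  qed (auto simp: wreath_def one shift_closed simp del: One_nat_def carrier_product_group mult_product_group one_product_group)
qed

end

theory Submission
  imports Defs
begin

text \<open>
  If \<open>f\<^sup>n = g\<close>, then \<open>\<delta>(g, 1, \<dots>, 1)\<close> is conjugate to the diagonal element \<open>\<alpha> = \<delta>(f, \<dots>, f)\<close>, by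
  the conjugator \<open>(f\<^sup>n\<^sup>-\<^sup>1, \<dots>, f, 1)\<close>; conversely, comparing entries in
  \<open>\<gamma> \<delta>(g, 1, \<dots>, 1) = \<delta>(h, \<dots>, h) \<gamma>\<close> exhibits \<open>g\<close> as an \<open>n\<close>th power. It remains to see that the
  ultra summit set of \<open>\<alpha>\<close> contains a diagonal element, that is, one commuting with \<open>\<delta>\<close>.

  The elements \<open>x\<close> such that \<open>x\<^sup>-\<^sup>1 \<alpha> x\<close> has infimum at least \<open>r\<close> are those with
  \<open>x \<Delta>\<^sup>r \<le> \<alpha> x\<close>. These inequalities, and the analogous ones \<open>\<alpha> x \<le> x \<Delta>\<^sup>s\<close> for the supremum, are
  preserved by meets, because left translations and right multiplication by \<open>\<Delta>\<close> are order automorphisms.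
  So the conjugators into the super summit set form a meet-closed set, which is nonempty, and since
  conjugation by \<open>\<delta>\<close> preserves it, its least element above a given power of \<open>\<Delta>\<close> commutes with
  \<open>\<delta>\<close>. This gives a diagonal element of the super summit set. Cycling is conjugation by a meet of
  elements commuting with \<open>\<delta>\<close>, so it stays among the diagonal elements of the super summit set, and
  since that set is finite its iterates are eventually periodic.
\<close>

text \<open>The values at least \<open>a\<close> form a finite set, and its \<open>Max\<close> is
  the greatest value overall. This is what makes the \<open>GREATEST\<close> in
  \<open>garside_inf\<close> and \<open>summit_inf\<close> usable.\<close>

lemma int_Greatest_bounded:
  fixes Q :: "int \<Rightarrow> bool"
  assumes "Q a" and "\<And>r. Q r \<Longrightarrow> r \<le> b"
  shows "Q (GREATEST r. Q r)" and "\<And>r. Q r \<Longrightarrow> r \<le> (GREATEST r. Q r)"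
proof -
  let ?S = "{r. Q r \<and> a \<le> r}"
  have "?S \<subseteq> {a..b}"
    using assms by auto
  then have fin: "finite ?S"
    by (rule finite_subset) simp
  have m: "Max ?S \<in> ?S"
    using fin assms(1) by (intro Max_in) auto
  have "r \<le> Max ?S" if "Q r" for r
  proof (cases "a \<le> r")
    case True
    then show ?thesis
      using that fin by (intro Max_ge) auto
  qed (use m in auto)
  moreover from this have "(GREATEST r. Q r) = Max ?S"
    using m by (intro Greatest_equality) auto
  ultimately show "Q (GREATEST r. Q r)" "\<And>r. Q r \<Longrightarrow> r \<le> (GREATEST r. Q r)"
    using m by auto
qed

lemma int_Least_bounded:
  fixes Q :: "int \<Rightarrow> bool"
  assumes "Q a" and "\<And>r. Q r \<Longrightarrow> b \<le> r"
  shows "Q (LEAST r. Q r)" and "\<And>r. Q r \<Longrightarrow> (LEAST r. Q r) \<le> r"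
proof -
  let ?S = "{r. Q r \<and> r \<le> a}"
  have "?S \<subseteq> {b..a}"
    using assms by auto
  then have fin: "finite ?S"
    by (rule finite_subset) simp
  have m: "Min ?S \<in> ?S"
    using fin assms(1) by (intro Min_in) auto
  have "Min ?S \<le> r" if "Q r" for r
  proof (cases "r \<le> a")
    case True
    then show ?thesis
      using that fin by (intro Min_le) auto
  qed (use m in auto)
  moreover from this have "(LEAST r. Q r) = Min ?S"
    using m by (intro Least_equality) auto
  ultimately show "Q (LEAST r. Q r)" "\<And>r. Q r \<Longrightarrow> (LEAST r. Q r) \<le> r"
    using m by auto
qed

lemma restrict_eq_iff: "(\<lambda>i \<in> A. a i) = (\<lambda>i \<in> A. b i) \<longleftrightarrow> (\<forall>i \<in> A. a i = b i)"
  by (metis restrict_apply' restrict_ext)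

section \<open>Commutation, conjugation and conjugacy classes\<close>

context group
begin

lemma inv_commute:
  assumes "z \<otimes> x = x \<otimes> z" "z \<in> carrier G" "x \<in> carrier G"
  shows "inv z \<otimes> x = x \<otimes> inv z"
proof -
  have "inv z \<otimes> x = inv z \<otimes> (x \<otimes> z) \<otimes> inv z"
    using assms(2,3) by (simp add: m_assoc)
  also have "\<dots> = inv z \<otimes> (z \<otimes> x) \<otimes> inv z"
    by (simp add: assms(1))
  also have "\<dots> = x \<otimes> inv z"
    using assms(2,3) by (simp add: m_assoc[symmetric])
  finally show ?thesis .
qed

lemma conj_cancel:
  assumes "z \<in> carrier G" "x \<in> carrier G"
  shows "z \<otimes> (inv z \<otimes> x \<otimes> z) \<otimes> inv z = x"
  using assms by (simp add: m_assoc) (simp add: m_assoc[symmetric])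

lemma conj_fixed_iff:
  assumes "z \<in> carrier G" "x \<in> carrier G"
  shows "z \<otimes> x \<otimes> inv z = x \<longleftrightarrow> z \<otimes> x = x \<otimes> z"
  using assms inv_solve_right'[of x "z \<otimes> x" z] by auto

lemma int_pow_commute:
  assumes "z \<otimes> x = x \<otimes> z" "z \<in> carrier G" "x \<in> carrier G"
  shows "z \<otimes> x [^] (r::int) = x [^] r \<otimes> z"
proof -
  have nat: "z \<otimes> x [^] (m::nat) = x [^] m \<otimes> z" for m
  proof (induction m)
    case (Suc m)
    then show ?case
      using assms by (simp add: m_assoc[symmetric]) (simp add: m_assoc)
  qed (use assms in simp)
  show ?thesis
  proof (cases r)
    case (nonneg m)
    then show ?thesis
      using nat by (simp add: int_pow_int)
  next
    case (neg m)
    have "inv (x [^] Suc m) \<otimes> z = z \<otimes> inv (x [^] Suc m)"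
      using nat[of "Suc m"] assms by (intro inv_commute) auto
    then show ?thesis
      unfolding neg int_pow_neg_int[OF assms(3)] by simp
  qed
qed

lemma commute_mult:
  assumes "z \<otimes> u = u \<otimes> z" "z \<otimes> v = v \<otimes> z" "z \<in> carrier G" "u \<in> carrier G" "v \<in> carrier G"
  shows "z \<otimes> (u \<otimes> v) = u \<otimes> v \<otimes> z"
proof -
  have "z \<otimes> (u \<otimes> v) = u \<otimes> (z \<otimes> v)"
    using assms(1,3-) by (simp add: m_assoc[symmetric])
  then show ?thesis
    using assms(2-) by (simp add: m_assoc)
qed

lemma conj_class_carrier: "\<lbrakk>h \<in> conj_class G g; g \<in> carrier G\<rbrakk> \<Longrightarrow> h \<in> carrier G"
  by (auto simp: conj_class_def)

lemma conj_class_self: "g \<in> carrier G \<Longrightarrow> g \<in> conj_class G g"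
  unfolding conj_class_def by (rule CollectI, rule exI[of _ \<one>]) simp

lemma conj_class_conj:
  assumes y: "y \<in> carrier G" and b: "b \<in> carrier G"
  shows "conj_class G (inv y \<otimes> b \<otimes> y) = conj_class G b"
proof -
  have sub: "conj_class G (inv y \<otimes> b \<otimes> y) \<subseteq> conj_class G b"
    if "y \<in> carrier G" "b \<in> carrier G" for y b
  proof
    fix c assume "c \<in> conj_class G (inv y \<otimes> b \<otimes> y)"
    then obtain x where x: "x \<in> carrier G" "c = inv x \<otimes> (inv y \<otimes> b \<otimes> y) \<otimes> x"
      by (auto simp: conj_class_def)
    then have "c = inv (y \<otimes> x) \<otimes> b \<otimes> (y \<otimes> x)"
      using that by (simp add: inv_mult_group m_assoc)
    then show "c \<in> conj_class G b"
      using that x unfolding conj_class_def by blast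
  qed
  \<comment> \<open>Conjugation by \<open>inv y\<close> undoes conjugation by \<open>y\<close>, so
    \<open>sub\<close> also yields the reverse inclusion.\<close>
  have "inv (inv y) \<otimes> (inv y \<otimes> b \<otimes> y) \<otimes> inv y = b"
    using assms by (simp add: m_assoc) (simp add: m_assoc[symmetric])
  then show ?thesis
    using sub[OF y b] sub[of "inv y" "inv y \<otimes> b \<otimes> y"] assms by simp
qed

lemma conj_nat_pow:
  assumes "x \<in> carrier G" "h \<in> carrier G"
  shows "(inv x \<otimes> h \<otimes> x) [^] (m::nat) = inv x \<otimes> h [^] m \<otimes> x"
proof (induction m)
  case (Suc m)
  have "inv x \<otimes> h [^] m \<otimes> x \<otimes> (inv x \<otimes> h \<otimes> x) = inv x \<otimes> h [^] m \<otimes> (x \<otimes> inv x) \<otimes> h \<otimes> x"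
    using assms by (simp only: m_assoc m_closed inv_closed nat_pow_closed)
  then show ?case
    using Suc assms by (simp add: m_assoc)
qed (use assms in simp)

lemma eq_conj_iff:
  assumes "x \<in> carrier G" "a \<in> carrier G" "b \<in> carrier G"
  shows "a = inv x \<otimes> b \<otimes> x \<longleftrightarrow> x \<otimes> a = b \<otimes> x"
  using assms by (metis inv_solve_left inv_closed m_assoc m_closed)

end

text \<open>Every ingredient of the set sees the base element only through its conjugacy class, so
  \<open>\<delta>(g, 1, ..., 1)\<close> may be traded for a diagonal conjugate.\<close>

lemma ultra_summit_set_cong:
  assumes "conj_class G a = conj_class G b"
  shows "ultra_summit_set G P \<Delta> a = ultra_summit_set G P \<Delta> b"
  using assms by (simp add: ultra_summit_set_def super_summit_set_def summit_inf_def summit_sup_def)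

section \<open>Transporters in quasi-Garside groups\<close>

text \<open>These are the properties of a Garside group that the argument needs; they are shared by \<open>G(n)\<close>,
  and checking them there is easier than checking the definition of a Garside group.\<close>

locale quasi_garside_group = group G for G (structure) +
  fixes P :: "'a set" and \<Delta> :: 'a
  assumes pos_submonoid: "submonoid P G"
    and pos_no_units: "\<lbrakk>a \<in> P; b \<in> P; a \<otimes> b = \<one>\<rbrakk> \<Longrightarrow> a = \<one>"
    and Delta_pos: "\<Delta> \<in> P"
    and Delta_right: "p \<in> P \<Longrightarrow> \<exists>q \<in> P. p \<otimes> \<Delta> = \<Delta> \<otimes> q"
    and Delta_left: "p \<in> P \<Longrightarrow> \<exists>q \<in> P. \<Delta> \<otimes> p = q \<otimes> \<Delta>"
    and glb_exists: "\<lbrakk>x \<in> carrier G; y \<in> carrier G\<rbrakk> \<Longrightarrow>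
      \<exists>m \<in> carrier G. le_left G P m x \<and> le_left G P m y \<and>
        (\<forall>z \<in> carrier G. le_left G P z x \<longrightarrow> le_left G P z y \<longrightarrow> le_left G P z m)"
    and Delta_cofinal: "g \<in> carrier G \<Longrightarrow> \<exists>m::nat. le_left G P g (\<Delta> [^] m)"
    and finite_divisors_Delta_pow: "finite {p \<in> P. le_left G P p (\<Delta> [^] (m::nat))}"
begin

section \<open>The left order, translations and powers of \<Delta>\<close>

abbreviation le_pos (infix "\<preceq>" 50) where "x \<preceq> y \<equiv> le_left G P x y"

abbreviation pos_meet (infixl "\<curlywedge>" 65) where "x \<curlywedge> y \<equiv> x \<sqinter>\<^bsub>left_order G P\<^esub> y"

lemma pos_carrier [simp, intro]: "p \<in> P \<Longrightarrow> p \<in> carrier G"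
  using submonoid.subset[OF pos_submonoid] by auto

lemma pos_one [simp, intro]: "\<one> \<in> P"
  using submonoid.one_closed[OF pos_submonoid] .

lemma pos_mult [simp, intro]: "\<lbrakk>p \<in> P; q \<in> P\<rbrakk> \<Longrightarrow> p \<otimes> q \<in> P"
  using submonoid.m_closed[OF pos_submonoid] .

lemma Delta_carrier [simp, intro]: "\<Delta> \<in> carrier G"
  using Delta_pos by blast

text \<open>In a group the quotient \<open>c\<close> is forced to be
  \<open>inv x \<otimes> y\<close>.\<close>

lemma le_iff: "\<lbrakk>x \<in> carrier G; y \<in> carrier G\<rbrakk> \<Longrightarrow> x \<preceq> y \<longleftrightarrow> inv x \<otimes> y \<in> P"
  unfolding le_left_def by (metis inv_solve_left' m_assoc pos_carrier inv_closed l_inv l_one r_inv)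

lemma le_refl [simp]: "x \<in> carrier G \<Longrightarrow> x \<preceq> x"
  by (simp add: le_iff)

lemma le_trans:
  assumes "x \<preceq> y" "y \<preceq> z" "x \<in> carrier G"
  shows "x \<preceq> z"
  using assms unfolding le_left_def by (metis m_assoc pos_carrier pos_mult)

lemma le_antisym:
  assumes "x \<preceq> y" "y \<preceq> x" "x \<in> carrier G"
  shows "x = y"
proof -
  obtain a b where ab: "a \<in> P" "b \<in> P" "x \<otimes> a = y" "y \<otimes> b = x"
    using assms unfolding le_left_def by blast
  then have "x \<otimes> (a \<otimes> b) = x"
    using assms by (simp add: m_assoc[symmetric])
  then have "a \<otimes> b = \<one>"
    using ab assms(3) by simp
  then have "a = \<one>"
    using pos_no_units ab by blast
  then show ?thesis
    using ab assms(3) by simp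
qed

lemma le_mult_left [simp]:
  "\<lbrakk>c \<in> carrier G; x \<in> carrier G; y \<in> carrier G\<rbrakk> \<Longrightarrow> c \<otimes> x \<preceq> c \<otimes> y \<longleftrightarrow> x \<preceq> y"
  unfolding le_left_def by (simp add: m_assoc cong: bex_cong)

lemma Delta_conj: "p \<in> P \<Longrightarrow> inv \<Delta> \<otimes> p \<otimes> \<Delta> \<in> P"
  using Delta_right[of p] by (metis Delta_carrier inv_solve_left m_assoc pos_carrier inv_closed m_closed)

lemma Delta_conj': "p \<in> P \<Longrightarrow> \<Delta> \<otimes> p \<otimes> inv \<Delta> \<in> P"
  using Delta_left[of p] by (metis Delta_carrier inv_solve_right pos_carrier m_closed)

text \<open>Right multiplication by \<Delta> conjugates the quotient
  \<open>inv x \<otimes> y\<close> by \<Delta>, and this conjugation preserves \<open>P\<close> in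
  both directions.\<close>

lemma le_mult_Delta [simp]:
  assumes "x \<in> carrier G" "y \<in> carrier G"
  shows "x \<otimes> \<Delta> \<preceq> y \<otimes> \<Delta> \<longleftrightarrow> x \<preceq> y"
proof -
  have *: "inv (x \<otimes> \<Delta>) \<otimes> (y \<otimes> \<Delta>) = inv \<Delta> \<otimes> (inv x \<otimes> y) \<otimes> \<Delta>"
    using assms by (simp add: inv_mult_group m_assoc)
  have "\<Delta> \<otimes> (inv \<Delta> \<otimes> (inv x \<otimes> y) \<otimes> \<Delta>) \<otimes> inv \<Delta> = inv x \<otimes> y"
    using assms by (simp add: m_assoc) (simp add: m_assoc[symmetric])
  then show ?thesis
    using assms Delta_conj[of "inv x \<otimes> y"] Delta_conj'[of "inv \<Delta> \<otimes> (inv x \<otimes> y) \<otimes> \<Delta>"]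
    by (auto simp: le_iff *)
qed

lemma le_mult_Delta_nat [simp]:
  assumes "x \<in> carrier G" "y \<in> carrier G"
  shows "x \<otimes> \<Delta> [^] (m::nat) \<preceq> y \<otimes> \<Delta> [^] m \<longleftrightarrow> x \<preceq> y"
proof (induction m)
  case (Suc m)
  then show ?case
    using assms by (simp add: m_assoc[symmetric])
qed (use assms in simp)

lemma le_mult_Delta_pow [simp]:
  assumes "x \<in> carrier G" "y \<in> carrier G"
  shows "x \<otimes> \<Delta> [^] (r::int) \<preceq> y \<otimes> \<Delta> [^] r \<longleftrightarrow> x \<preceq> y"
proof (cases r)
  case (nonneg m)
  then show ?thesis
    using assms by (simp add: int_pow_int)
next
  case (neg m)
  \<comment> \<open>The case \<open>neg m\<close> stands for \<open>r = - int (Suc m)\<close>;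
    multiplying both sides by \<open>D\<close> reduces it to a natural exponent.\<close>
  define D where "D = \<Delta> [^] Suc m"
  have D: "\<Delta> [^] r = inv D" "D \<in> carrier G"
    using neg int_pow_neg_int[of \<Delta> "Suc m"] by (auto simp: D_def simp del: nat_pow_Suc)
  have "x \<otimes> inv D \<preceq> y \<otimes> inv D \<longleftrightarrow> x \<otimes> inv D \<otimes> D \<preceq> y \<otimes> inv D \<otimes> D"
    using assms D(2) unfolding D_def by (intro le_mult_Delta_nat[symmetric]) auto
  also have "\<dots> \<longleftrightarrow> x \<preceq> y"
    using assms D by (simp add: m_assoc)
  finally show ?thesis
    using D by simp
qed

lemma le_mult_pos: "\<lbrakk>x \<in> carrier G; p \<in> P\<rbrakk> \<Longrightarrow> x \<preceq> x \<otimes> p"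
  unfolding le_left_def by blast

lemma one_le_iff: "x \<in> carrier G \<Longrightarrow> \<one> \<preceq> x \<longleftrightarrow> x \<in> P"
  by (simp add: le_iff)

lemma Delta_nat_pow_pos [simp]: "\<Delta> [^] (m::nat) \<in> P"
  using Delta_pos by (induction m) auto

lemma Delta_pow_mono:
  assumes "r \<le> s"
  shows "\<Delta> [^] (r::int) \<preceq> \<Delta> [^] s"
proof -
  have "\<Delta> [^] s = \<Delta> [^] r \<otimes> \<Delta> [^] nat (s - r)"
    using assms int_pow_mult[of \<Delta> r "s - r"] by (simp flip: int_pow_int)
  then show ?thesis
    using le_mult_pos[of "\<Delta> [^] r" "\<Delta> [^] nat (s - r)"] by simp
qed

lemma Delta_pow_above: "g \<in> carrier G \<Longrightarrow> \<exists>m::int. g \<preceq> \<Delta> [^] m"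
  using Delta_cofinal by (metis int_pow_int)

text \<open>Cofinality bounds \<open>inv g\<close> above by a power of \<Delta>; translating by
  \<open>g\<close> on the left and by the inverse power on the right turns this into a lower bound
  for \<open>g\<close>.\<close>

lemma Delta_pow_below:
  assumes g: "g \<in> carrier G"
  shows "\<exists>m::int. \<Delta> [^] m \<preceq> g"
proof -
  obtain m :: int where "inv g \<preceq> \<Delta> [^] m"
    using Delta_pow_above g by blast
  then have "g \<otimes> inv g \<preceq> g \<otimes> \<Delta> [^] m"
    using g by (simp only: le_mult_left inv_closed int_pow_closed Delta_carrier)
  then have "g \<otimes> inv g \<otimes> \<Delta> [^] (- m) \<preceq> g \<otimes> \<Delta> [^] m \<otimes> \<Delta> [^] (- m)"
    using g by (simp only: le_mult_Delta_pow inv_closed int_pow_closed m_closed Delta_carrier)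
  then have "\<Delta> [^] (- m) \<preceq> g"
    using g by (simp add: m_assoc[of g] int_pow_mult[symmetric])
  then show ?thesis ..
qed

text \<open>Left translation by \<open>inv a\<close> carries the interval into the positive divisors
  of a power of \<Delta>.\<close>

lemma finite_interval:
  assumes a: "a \<in> carrier G" and b: "b \<in> carrier G"
  shows "finite {x \<in> carrier G. a \<preceq> x \<and> x \<preceq> b}"
proof -
  obtain m :: nat where m: "inv a \<otimes> b \<preceq> \<Delta> [^] m"
    using Delta_cofinal a b by blast
  have "x \<in> (\<otimes>) a ` {p \<in> P. p \<preceq> \<Delta> [^] m}" if "x \<in> carrier G" "a \<preceq> x" "x \<preceq> b" for x
  proof
    show "x = a \<otimes> (inv a \<otimes> x)"
      using a that by (simp add: m_assoc[symmetric])
    have "inv a \<otimes> x \<preceq> inv a \<otimes> b"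
      using a b that by simp
    then show "inv a \<otimes> x \<in> {p \<in> P. p \<preceq> \<Delta> [^] m}"
      using a that m le_trans[of "inv a \<otimes> x" "inv a \<otimes> b"] by (auto simp: le_iff[of a x])
  qed
  then have "{x \<in> carrier G. a \<preceq> x \<and> x \<preceq> b} \<subseteq> (\<otimes>) a ` {p \<in> P. p \<preceq> \<Delta> [^] m}"
    by blast
  then show ?thesis
    using finite_divisors_Delta_pow finite_subset by blast
qed

section \<open>Meets and least elements of meet-closed sets\<close>

lemma meet_eqI:
  assumes "x \<in> carrier G" "y \<in> carrier G" "m \<in> carrier G" "m \<preceq> x" "m \<preceq> y"
    and "\<And>z. \<lbrakk>z \<in> carrier G; z \<preceq> x; z \<preceq> y\<rbrakk> \<Longrightarrow> z \<preceq> m"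
  shows "x \<curlywedge> y = m"
proof -
  have "greatest (left_order G P) k (Lower (left_order G P) {x, y}) \<longleftrightarrow>
      k \<in> carrier G \<and> k \<preceq> x \<and> k \<preceq> y \<and> (\<forall>z \<in> carrier G. z \<preceq> x \<longrightarrow> z \<preceq> y \<longrightarrow> z \<preceq> k)" for k
    using assms(1,2) by (auto simp: greatest_def Lower_def left_order_def)
  then show ?thesis
    \<comment> \<open>The meet is a Hilbert choice among greatest lower bounds; antisymmetry leaves
      one candidate.\<close>
    unfolding meet_def Lattice.inf_def using assms by (intro some_equality) (auto intro: le_antisym)
qed

lemma
  assumes "x \<in> carrier G" "y \<in> carrier G"
  shows meet_closed [simp, intro]: "x \<curlywedge> y \<in> carrier G"
    and meet_le1: "x \<curlywedge> y \<preceq> x"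
    and meet_le2: "x \<curlywedge> y \<preceq> y"
    and meet_greatest: "\<lbrakk>z \<in> carrier G; z \<preceq> x; z \<preceq> y\<rbrakk> \<Longrightarrow> z \<preceq> x \<curlywedge> y"
proof -
  obtain m where m: "m \<in> carrier G" "m \<preceq> x" "m \<preceq> y"
    and gr: "\<And>z. \<lbrakk>z \<in> carrier G; z \<preceq> x; z \<preceq> y\<rbrakk> \<Longrightarrow> z \<preceq> m"
    using glb_exists[OF assms] by blast
  have "x \<curlywedge> y = m"
    using assms m gr by (rule meet_eqI)
  then show "x \<curlywedge> y \<in> carrier G" "x \<curlywedge> y \<preceq> x" "x \<curlywedge> y \<preceq> y"
    "\<lbrakk>z \<in> carrier G; z \<preceq> x; z \<preceq> y\<rbrakk> \<Longrightarrow> z \<preceq> x \<curlywedge> y"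
    using m gr by auto
qed

text \<open>Right multiplication by a power of \<Delta> is an order automorphism, so every lower
  bound of the translates is the translate of a lower bound \<open>w\<close>.\<close>

lemma meet_mult_Delta_pow:
  assumes "x \<in> carrier G" "y \<in> carrier G"
  shows "x \<otimes> \<Delta> [^] (r::int) \<curlywedge> y \<otimes> \<Delta> [^] r = (x \<curlywedge> y) \<otimes> \<Delta> [^] r"
proof (rule meet_eqI)
  fix z assume z: "z \<in> carrier G" "z \<preceq> x \<otimes> \<Delta> [^] r" "z \<preceq> y \<otimes> \<Delta> [^] r"
  define w where "w = z \<otimes> \<Delta> [^] (- r)"
  have w: "z = w \<otimes> \<Delta> [^] r" "w \<in> carrier G"
    using z by (auto simp: w_def m_assoc int_pow_mult[symmetric])
  then show "z \<preceq> (x \<curlywedge> y) \<otimes> \<Delta> [^] r"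
    using z assms meet_greatest by simp
qed (use assms meet_le1 meet_le2 in auto)

lemma meet_mult_left:
  assumes "c \<in> carrier G" "x \<in> carrier G" "y \<in> carrier G"
  shows "c \<otimes> x \<curlywedge> c \<otimes> y = c \<otimes> (x \<curlywedge> y)"
proof (rule meet_eqI)
  fix z assume z: "z \<in> carrier G" "z \<preceq> c \<otimes> x" "z \<preceq> c \<otimes> y"
  define w where "w = inv c \<otimes> z"
  have w: "z = c \<otimes> w" "w \<in> carrier G"
    using z assms by (auto simp: w_def m_assoc[symmetric])
  then show "z \<preceq> c \<otimes> (x \<curlywedge> y)"
    using z assms meet_greatest by simp
qed (use assms meet_le1 meet_le2 in auto)

lemma meet_pos: "\<lbrakk>x \<in> P; y \<in> P\<rbrakk> \<Longrightarrow> x \<curlywedge> y \<in> P"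
  using meet_greatest[of x y \<one>] by (simp add: one_le_iff)

text \<open>The bound \<open>b\<close> leaves only finitely many elements of \<open>S\<close> below
  each of its members. Choose \<open>m\<close> with the fewest: \<open>m \<curlywedge> x\<close> has
  no fewer, so the elements of \<open>S\<close> below \<open>m\<close> and below
  \<open>m \<curlywedge> x\<close> coincide, and \<open>m\<close> is among them.\<close>

lemma ex_minimum:
  assumes "S \<subseteq> carrier G" "s \<in> S" "b \<in> carrier G"
    and below: "\<And>x. x \<in> S \<Longrightarrow> b \<preceq> x"
    and meet: "\<And>x y. \<lbrakk>x \<in> S; y \<in> S\<rbrakk> \<Longrightarrow> x \<curlywedge> y \<in> S"
  shows "\<exists>m \<in> S. \<forall>x \<in> S. m \<preceq> x"
proof -
  let ?D = "\<lambda>x. {y \<in> S. y \<preceq> x}"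
  have fin: "finite (?D x)" if "x \<in> S" for x
  proof -
    have "?D x \<subseteq> {y \<in> carrier G. b \<preceq> y \<and> y \<preceq> x}"
      using assms(1) below by auto
    then show ?thesis
      using finite_interval[of b x] that assms(1,3) finite_subset by blast
  qed
  obtain m where m: "m \<in> S" and min: "\<And>x. x \<in> S \<Longrightarrow> card (?D m) \<le> card (?D x)"
    using ex_has_least_nat[of "\<lambda>x. x \<in> S", OF assms(2), of "\<lambda>x. card (?D x)"] by auto
  have "m \<preceq> x" if x: "x \<in> S" for x
  proof -
    have c: "m \<in> carrier G" "x \<in> carrier G"
      using assms(1) m x by auto
    have S: "m \<curlywedge> x \<in> S"
      using m x by (rule meet)
    have "?D (m \<curlywedge> x) \<subseteq> ?D m"
    proof
      fix y assume "y \<in> ?D (m \<curlywedge> x)"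
      then show "y \<in> ?D m"
        using le_trans[OF _ meet_le1[OF c]] assms(1) by auto
    qed
    then have "?D (m \<curlywedge> x) = ?D m"
      using fin[OF m] min[OF S] by (intro card_seteq)
    moreover have "m \<in> ?D m"
      using m c by simp
    ultimately have "m \<preceq> m \<curlywedge> x"
      by blast
    then show ?thesis
      using le_trans[OF _ meet_le2[OF c] c(1)] by blast
  qed
  then show ?thesis
    using m by blast
qed

text \<open>If \<open>p \<and> \<Delta> = 1\<close> then \<open>p \<and> \<Delta>\<^sup>m\<^sup>+\<^sup>1 \<le> p \<Delta>\<^sup>m \<and> \<Delta>\<^sup>m\<^sup>+\<^sup>1 = (p \<and> \<Delta>) \<Delta>\<^sup>m\<close>, hence \<open>p \<and> \<Delta>\<^sup>m = 1\<close>
  for all \<open>m\<close>.\<close>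

lemma meet_Delta_eq_one:
  assumes p: "p \<in> P" and "p \<curlywedge> \<Delta> = \<one>"
  shows "p = \<one>"
proof -
  have le1: "z \<preceq> \<one>" if z: "z \<in> carrier G" "z \<preceq> p" "z \<preceq> \<Delta> [^] m" for m :: nat and z
    using z
  proof (induction m)
    case (Suc m)
    have "z \<preceq> p \<otimes> \<Delta> [^] m"
      using Suc.prems p le_trans[of z p] le_mult_pos[of p "\<Delta> [^] m"] by simp
    moreover have "z \<preceq> \<Delta> \<otimes> \<Delta> [^] m"
      using Suc.prems nat_pow_Suc2[of \<Delta> m] by simp
    ultimately have "z \<preceq> (p \<curlywedge> \<Delta>) \<otimes> \<Delta> [^] m"
      using p Suc.prems meet_greatest[of "p \<otimes> \<Delta> [^] m" "\<Delta> \<otimes> \<Delta> [^] m" z]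
        meet_mult_Delta_pow[of p \<Delta> "int m"] by (simp add: int_pow_int)
    then show ?case
      using Suc assms(2) by simp
  qed simp
  obtain m :: nat where "p \<preceq> \<Delta> [^] m"
    using Delta_cofinal p by blast
  then have "p \<preceq> \<one>"
    using le1 p by simp
  then show ?thesis
    using p le_antisym[of p \<one>] by (simp add: one_le_iff)
qed

lemma list_prod_Nil [simp]: "list_prod G [] = \<one>"
  by (simp add: list_prod_def)

lemma list_prod_Cons [simp]: "list_prod G (s # ss) = s \<otimes> list_prod G ss"
  by (simp add: list_prod_def)

section \<open>Conjugators that bound the infimum or the supremum\<close>

definition inf_transporters :: "'a \<Rightarrow> int \<Rightarrow> 'a set" where
  "inf_transporters g r = {x \<in> carrier G. x \<otimes> \<Delta> [^] r \<preceq> g \<otimes> x}"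

definition sup_transporters :: "'a \<Rightarrow> int \<Rightarrow> 'a set" where
  "sup_transporters g s = {x \<in> carrier G. g \<otimes> x \<preceq> x \<otimes> \<Delta> [^] s}"

text \<open>Left translation by \<open>x\<close> links the two forms. The defining one involves only
  translates of \<open>x\<close>, which is what lets meets pass through it.\<close>

lemma inf_transporters_iff:
  assumes "g \<in> carrier G" "x \<in> carrier G"
  shows "x \<in> inf_transporters g r \<longleftrightarrow> \<Delta> [^] r \<preceq> inv x \<otimes> g \<otimes> x"
proof -
  have "x \<otimes> \<Delta> [^] r \<preceq> x \<otimes> (inv x \<otimes> g \<otimes> x) \<longleftrightarrow> \<Delta> [^] r \<preceq> inv x \<otimes> g \<otimes> x"
    using assms by simp
  moreover have "x \<otimes> (inv x \<otimes> g \<otimes> x) = g \<otimes> x"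
    using assms by (simp add: m_assoc[symmetric])
  ultimately show ?thesis
    using assms by (simp add: inf_transporters_def)
qed

lemma sup_transporters_iff:
  assumes "g \<in> carrier G" "x \<in> carrier G"
  shows "x \<in> sup_transporters g s \<longleftrightarrow> inv x \<otimes> g \<otimes> x \<preceq> \<Delta> [^] s"
proof -
  have "x \<otimes> (inv x \<otimes> g \<otimes> x) \<preceq> x \<otimes> \<Delta> [^] s \<longleftrightarrow> inv x \<otimes> g \<otimes> x \<preceq> \<Delta> [^] s"
    using assms by simp
  moreover have "x \<otimes> (inv x \<otimes> g \<otimes> x) = g \<otimes> x"
    using assms by (simp add: m_assoc[symmetric])
  ultimately show ?thesis
    using assms by (simp add: sup_transporters_def)
qed

lemma meet_inf_transporters:
  assumes g: "g \<in> carrier G" and "x \<in> inf_transporters g r" "y \<in> inf_transporters g r"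
  shows "x \<curlywedge> y \<in> inf_transporters g r"
proof -
  have x: "x \<in> carrier G" "x \<otimes> \<Delta> [^] r \<preceq> g \<otimes> x" and y: "y \<in> carrier G" "y \<otimes> \<Delta> [^] r \<preceq> g \<otimes> y"
    using assms by (auto simp: inf_transporters_def)
  let ?m = "(x \<curlywedge> y) \<otimes> \<Delta> [^] r"
  have "?m \<preceq> g \<otimes> x" "?m \<preceq> g \<otimes> y"
    using x y g meet_le1[of x y] meet_le2[of x y] le_trans[OF _ x(2)] le_trans[OF _ y(2)] by simp_all
  then have "?m \<preceq> g \<otimes> (x \<curlywedge> y)"
    using x y g meet_greatest[of "g \<otimes> x" "g \<otimes> y"] by (simp add: meet_mult_left)
  then show ?thesis
    using x y by (simp add: inf_transporters_def)
qed

lemma meet_sup_transporters: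
  assumes g: "g \<in> carrier G" and "x \<in> sup_transporters g s" "y \<in> sup_transporters g s"
  shows "x \<curlywedge> y \<in> sup_transporters g s"
proof -
  have x: "x \<in> carrier G" "g \<otimes> x \<preceq> x \<otimes> \<Delta> [^] s" and y: "y \<in> carrier G" "g \<otimes> y \<preceq> y \<otimes> \<Delta> [^] s"
    using assms by (auto simp: sup_transporters_def)
  have "g \<otimes> (x \<curlywedge> y) \<preceq> x \<otimes> \<Delta> [^] s" "g \<otimes> (x \<curlywedge> y) \<preceq> y \<otimes> \<Delta> [^] s"
    using x y g meet_le1[of x y] meet_le2[of x y] le_trans[OF _ x(2)] le_trans[OF _ y(2)] by simp_all
  then have "g \<otimes> (x \<curlywedge> y) \<preceq> (x \<curlywedge> y) \<otimes> \<Delta> [^] s"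
    using x y g meet_greatest[of "x \<otimes> \<Delta> [^] s" "y \<otimes> \<Delta> [^] s"] by (simp add: meet_mult_Delta_pow)
  then show ?thesis
    using x y by (simp add: sup_transporters_def)
qed

lemma Delta_pow_commute: "\<Delta> [^] (r::int) \<otimes> \<Delta> [^] (s::int) = \<Delta> [^] s \<otimes> \<Delta> [^] r"
  using int_pow_mult[of \<Delta> r s] int_pow_mult[of \<Delta> s r] by (simp add: add.commute)

lemma inf_transporters_mult_Delta_pow:
  assumes "x \<in> inf_transporters g r" "g \<in> carrier G"
  shows "x \<otimes> \<Delta> [^] (k::int) \<in> inf_transporters g r"
proof -
  have "x \<otimes> \<Delta> [^] r \<otimes> \<Delta> [^] k \<preceq> g \<otimes> x \<otimes> \<Delta> [^] k"
    using assms by (simp add: inf_transporters_def)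
  then show ?thesis
    using assms by (simp add: inf_transporters_def m_assoc Delta_pow_commute[of k r])
qed

lemma sup_transporters_mult_Delta_pow:
  assumes "x \<in> sup_transporters g s" "g \<in> carrier G"
  shows "x \<otimes> \<Delta> [^] (k::int) \<in> sup_transporters g s"
proof -
  have "g \<otimes> x \<otimes> \<Delta> [^] k \<preceq> x \<otimes> \<Delta> [^] s \<otimes> \<Delta> [^] k"
    using assms by (simp add: sup_transporters_def)
  then show ?thesis
    using assms by (simp add: sup_transporters_def m_assoc Delta_pow_commute[of k s])
qed

text \<open>If \<open>c\<close> commutes with \<open>g\<close>, then \<open>c \<otimes> x\<close>
  and \<open>x\<close> conjugate \<open>g\<close> to the same element.\<close>

lemma inf_transporters_centralizer:
  assumes "x \<in> inf_transporters g r" "g \<in> carrier G" "c \<in> carrier G" "c \<otimes> g = g \<otimes> c"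
  shows "c \<otimes> x \<in> inf_transporters g r"
proof -
  have "c \<otimes> (x \<otimes> \<Delta> [^] r) \<preceq> c \<otimes> (g \<otimes> x)"
    using assms by (simp add: inf_transporters_def)
  moreover have "c \<otimes> (g \<otimes> x) = g \<otimes> (c \<otimes> x)"
    using assms by (simp add: inf_transporters_def m_assoc[symmetric])
  ultimately show ?thesis
    using assms by (simp add: inf_transporters_def m_assoc)
qed

lemma sup_transporters_centralizer:
  assumes "x \<in> sup_transporters g s" "g \<in> carrier G" "c \<in> carrier G" "c \<otimes> g = g \<otimes> c"
  shows "c \<otimes> x \<in> sup_transporters g s"
proof -
  have "c \<otimes> (g \<otimes> x) \<preceq> c \<otimes> (x \<otimes> \<Delta> [^] s)"
    using assms by (simp add: sup_transporters_def)
  moreover have "c \<otimes> (g \<otimes> x) = g \<otimes> (c \<otimes> x)"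
    using assms by (simp add: sup_transporters_def m_assoc[symmetric])
  ultimately show ?thesis
    using assms by (simp add: sup_transporters_def m_assoc)
qed

text \<open>The least element \<open>z\<close> of \<open>inf_transporters g r\<close> above an element \<open>y\<close> of
  \<open>sup_transporters g s\<close> lies in \<open>sup_transporters g s\<close>: the element \<open>g\<^sup>-\<^sup>1 z \<Delta>\<^sup>s\<close> also belongs to
  \<open>inf_transporters g r\<close> and is above \<open>y\<close>.\<close>

lemma inf_sup_transporters_nonempty:
  assumes g: "g \<in> carrier G" and x: "x \<in> inf_transporters g r" and y: "y \<in> sup_transporters g s"
  shows "\<exists>z. z \<in> inf_transporters g r \<inter> sup_transporters g s"
proof -
  have c: "x \<in> carrier G" "y \<in> carrier G"
    using x y by (auto simp: inf_transporters_def sup_transporters_def)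
  define S where "S = {z \<in> inf_transporters g r. y \<preceq> z}"
  have S: "S \<subseteq> carrier G"
    by (auto simp: S_def inf_transporters_def)
  \<comment> \<open>A power of \<Delta> lifts \<open>x\<close> above \<open>y\<close>, so
    \<open>S\<close> is nonempty.\<close>
  obtain m :: nat where "inv x \<otimes> y \<preceq> \<Delta> [^] m"
    using Delta_cofinal c by blast
  then have "x \<otimes> (inv x \<otimes> y) \<preceq> x \<otimes> \<Delta> [^] m"
    using c by simp
  then have "x \<otimes> \<Delta> [^] int m \<in> S"
    using x g c inf_transporters_mult_Delta_pow[of x g r "int m"]
    by (simp add: S_def m_assoc[symmetric] int_pow_int)
  moreover have "u \<curlywedge> v \<in> S" if "u \<in> S" "v \<in> S" for u v
    using that S c meet_inf_transporters[OF g] meet_greatest[of u v y] by (auto simp: S_def)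
  moreover have "y \<preceq> u" if "u \<in> S" for u
    using that by (simp add: S_def)
  ultimately obtain z where z: "z \<in> S" and min: "\<And>w. w \<in> S \<Longrightarrow> z \<preceq> w"
    using ex_minimum[OF S _ c(2)] by metis
  have zc: "z \<in> carrier G"
    using z S by blast
  have "y \<otimes> \<Delta> [^] s \<preceq> z \<otimes> \<Delta> [^] s" "g \<otimes> y \<preceq> y \<otimes> \<Delta> [^] s"
    using z zc c y by (auto simp: S_def sup_transporters_def)
  then have "inv g \<otimes> (g \<otimes> y) \<preceq> inv g \<otimes> (z \<otimes> \<Delta> [^] s)"
    using g c zc le_trans[of "g \<otimes> y"] by simp
  \<comment> \<open>Right multiplication by \<open>\<Delta> [^] s\<close> preserves transporters,
    and so does left multiplication by \<open>inv g\<close>, which commutes with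
    \<open>g\<close>.\<close>
  moreover have "inv g \<otimes> (z \<otimes> \<Delta> [^] s) \<in> inf_transporters g r"
    using z g by (intro inf_transporters_centralizer inf_transporters_mult_Delta_pow) (auto simp: S_def)
  ultimately have "z \<preceq> inv g \<otimes> (z \<otimes> \<Delta> [^] s)"
    using g c by (intro min) (simp add: S_def m_assoc[symmetric])
  then have "g \<otimes> z \<preceq> g \<otimes> (inv g \<otimes> (z \<otimes> \<Delta> [^] s))"
    using g zc by simp
  then have "z \<in> sup_transporters g s"
    using g zc by (simp add: sup_transporters_def m_assoc[symmetric])
  then show ?thesis
    using z by (auto simp: S_def)
qed

text \<open>Both conjugations are required to preserve \<open>P\<close>, so conjugation by
  \<open>z\<close> maps \<open>P\<close> onto \<open>P\<close> and is an automorphism of the ordered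
  group fixing \<Delta>. In \<open>G(n)\<close> the element of interest is \<delta>.\<close>

definition order_normalizer :: "'a set" where
  "order_normalizer = {z \<in> carrier G. z \<otimes> \<Delta> = \<Delta> \<otimes> z \<and>
     (\<forall>p \<in> P. z \<otimes> p \<otimes> inv z \<in> P \<and> inv z \<otimes> p \<otimes> z \<in> P)}"

lemma inv_order_normalizer:
  assumes "z \<in> order_normalizer"
  shows "inv z \<in> order_normalizer"
proof -
  have z: "z \<in> carrier G" "z \<otimes> \<Delta> = \<Delta> \<otimes> z"
    using assms by (auto simp: order_normalizer_def)
  then have "inv z \<otimes> \<Delta> = \<Delta> \<otimes> inv z"
    by (intro inv_commute) auto
  then show ?thesis
    using assms by (auto simp: order_normalizer_def)
qed

text \<open>The quotient \<open>inv x \<otimes> y\<close> is conjugated along with \<open>x\<close>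
  and \<open>y\<close>, hence stays in \<open>P\<close>.\<close>

lemma conj_le:
  assumes z: "z \<in> order_normalizer" and xy: "x \<in> carrier G" "y \<in> carrier G" and "x \<preceq> y"
  shows "z \<otimes> x \<otimes> inv z \<preceq> z \<otimes> y \<otimes> inv z"
proof -
  have zc: "z \<in> carrier G" and "z \<otimes> (inv x \<otimes> y) \<otimes> inv z \<in> P"
    using z xy assms(4) by (auto simp: order_normalizer_def le_iff)
  moreover have "inv (x \<otimes> inv z) \<otimes> (y \<otimes> inv z) = z \<otimes> (inv x \<otimes> y) \<otimes> inv z"
    using xy zc by (simp add: inv_mult_group m_assoc)
  ultimately have "x \<otimes> inv z \<preceq> y \<otimes> inv z"
    using xy by (simp add: le_iff)
  then show ?thesis
    using xy zc by (simp add: m_assoc)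
qed

text \<open>Conjugation by \<open>z\<close> and by \<open>inv z\<close> fixes \<open>x\<close> and
  \<open>y\<close>, so each sends their meet to a lower bound of them, hence below the meet. The two
  inequalities together give equality.\<close>

lemma meet_commute_normalizer:
  assumes z: "z \<in> order_normalizer" and xy: "x \<in> carrier G" "y \<in> carrier G"
    and zx: "z \<otimes> x = x \<otimes> z" and zy: "z \<otimes> y = y \<otimes> z"
  shows "z \<otimes> (x \<curlywedge> y) = (x \<curlywedge> y) \<otimes> z"
proof -
  have zc: "z \<in> carrier G"
    using z by (simp add: order_normalizer_def)
  have le: "w \<otimes> (x \<curlywedge> y) \<otimes> inv w \<preceq> x \<curlywedge> y"
    if w: "w \<in> order_normalizer" "w \<in> carrier G" "w \<otimes> x = x \<otimes> w" "w \<otimes> y = y \<otimes> w" for w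
    using conj_le[OF w(1) _ xy(1) meet_le1] conj_le[OF w(1) _ xy(2) meet_le2] w xy
      conj_fixed_iff[of w x] conj_fixed_iff[of w y]
    by (intro meet_greatest) auto
  have "inv z \<otimes> (x \<curlywedge> y) \<otimes> z \<preceq> x \<curlywedge> y"
    using le[OF inv_order_normalizer[OF z]] inv_commute[OF zx] inv_commute[OF zy] zc xy by simp
  then have "x \<curlywedge> y \<preceq> z \<otimes> (x \<curlywedge> y) \<otimes> inv z"
    using conj_le[OF z, of "inv z \<otimes> (x \<curlywedge> y) \<otimes> z" "x \<curlywedge> y"] xy zc by (simp add: conj_cancel)
  then show ?thesis
    using le[OF z zc zx zy] zc xy le_antisym conj_fixed_iff[of z "x \<curlywedge> y"] by simp
qed

text \<open>As \<open>z\<close> commutes with \<open>g\<close> and \<Delta>, conjugating the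
  defining inequalities merely replaces \<open>x\<close> by its conjugate.\<close>

lemma conj_transporters:
  assumes z: "z \<in> order_normalizer" and g: "g \<in> carrier G" and zg: "z \<otimes> g = g \<otimes> z"
    and x: "x \<in> inf_transporters g r \<inter> sup_transporters g s"
  shows "z \<otimes> x \<otimes> inv z \<in> inf_transporters g r \<inter> sup_transporters g s"
proof -
  have zc: "z \<in> carrier G" and zD: "z \<otimes> \<Delta> = \<Delta> \<otimes> z"
    using z by (auto simp: order_normalizer_def)
  have xc: "x \<in> carrier G" "x \<otimes> \<Delta> [^] r \<preceq> g \<otimes> x" "g \<otimes> x \<preceq> x \<otimes> \<Delta> [^] s"
    using x by (auto simp: inf_transporters_def sup_transporters_def)
  have D: "z \<otimes> (x \<otimes> \<Delta> [^] t) \<otimes> inv z = z \<otimes> x \<otimes> inv z \<otimes> \<Delta> [^] t" for t :: int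
    using int_pow_commute[OF inv_commute[OF zD], of t] zc xc(1) by (simp add: m_assoc)
  have G: "z \<otimes> (g \<otimes> x) \<otimes> inv z = g \<otimes> (z \<otimes> x \<otimes> inv z)"
    using zg zc xc(1) g by (simp add: m_assoc[symmetric])
  show ?thesis
    using conj_le[OF z _ _ xc(2)] conj_le[OF z _ _ xc(3)] zc xc(1) g
    by (simp add: inf_transporters_def sup_transporters_def D G)
qed

text \<open>Conjugation by \<open>z\<close> permutes the transporters above \<open>\<Delta>\<^sup>k\<close>, so it fixes the least one.\<close>

lemma ex_commuting_transporter:
  assumes z: "z \<in> order_normalizer" and g: "g \<in> carrier G" and zg: "z \<otimes> g = g \<otimes> z"
    and ne: "y \<in> inf_transporters g r \<inter> sup_transporters g s"
  shows "\<exists>x \<in> inf_transporters g r \<inter> sup_transporters g s. z \<otimes> x = x \<otimes> z"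
proof -
  have zc: "z \<in> carrier G" and zD: "z \<otimes> \<Delta> = \<Delta> \<otimes> z"
    using z by (auto simp: order_normalizer_def)
  have yc: "y \<in> carrier G"
    using ne by (simp add: inf_transporters_def)
  \<comment> \<open>This power is a lower bound for \<open>S\<close>, as \<open>ex_minimum\<close>
    demands, and it is fixed under conjugation by \<open>z\<close>.\<close>
  obtain k :: int where k: "\<Delta> [^] k \<preceq> y"
    using Delta_pow_below[OF yc] by blast
  define S where "S = {x \<in> inf_transporters g r \<inter> sup_transporters g s. \<Delta> [^] k \<preceq> x}"
  have S: "S \<subseteq> carrier G" and yS: "y \<in> S" and low: "\<And>x. x \<in> S \<Longrightarrow> \<Delta> [^] k \<preceq> x"
    using ne k by (auto simp: S_def inf_transporters_def)
  have "u \<curlywedge> v \<in> S" if "u \<in> S" "v \<in> S" for u v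
    using that S meet_inf_transporters[OF g] meet_sup_transporters[OF g] meet_greatest[of u v "\<Delta> [^] k"]
    by (simp add: S_def subset_iff)
  then obtain x where x: "x \<in> S" and min: "\<And>w. w \<in> S \<Longrightarrow> x \<preceq> w"
    using ex_minimum[OF S yS int_pow_closed[OF Delta_carrier] low] by metis
  have xc: "x \<in> carrier G"
    using x S by blast
  have conj: "x \<preceq> w \<otimes> x \<otimes> inv w"
    if w: "w \<in> order_normalizer" "w \<in> carrier G" "w \<otimes> g = g \<otimes> w" "w \<otimes> \<Delta> = \<Delta> \<otimes> w" for w
  proof (rule min)
    have "w \<otimes> \<Delta> [^] k \<otimes> inv w \<preceq> w \<otimes> x \<otimes> inv w"
      using x xc w by (intro conj_le) (auto simp: S_def)
    moreover have "w \<otimes> \<Delta> [^] k \<otimes> inv w = \<Delta> [^] k"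
      using w int_pow_commute[OF w(4)] conj_fixed_iff[of w "\<Delta> [^] k"] by simp
    ultimately show "w \<otimes> x \<otimes> inv w \<in> S"
      using x conj_transporters[OF w(1) g w(3), of x r s] by (simp add: S_def)
  qed
  \<comment> \<open>Minimality against the conjugate by \<open>inv z\<close>, conjugated back by
    \<open>z\<close>, is the reverse inequality.\<close>
  have "x \<preceq> inv z \<otimes> x \<otimes> z"
    using conj[OF inv_order_normalizer[OF z]] inv_commute[OF zg] inv_commute[OF zD] zc g by simp
  then have "z \<otimes> x \<otimes> inv z \<preceq> x"
    using conj_le[OF z, of x "inv z \<otimes> x \<otimes> z"] xc zc by (simp add: conj_cancel)
  then have "z \<otimes> x = x \<otimes> z"
    using conj[OF z zc zg zD] zc xc le_antisym[of "z \<otimes> x \<otimes> inv z" x] conj_fixed_iff[of z x] by simp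
  then show ?thesis
    using x by (auto simp: S_def)
qed

end

section \<open>Normal forms and cycling\<close>

text \<open>The degree bounds infimum and supremum on a conjugacy class. In \<open>G(n)\<close> it is the exponent of
  \<open>\<delta>\<close>.\<close>

locale graded_garside_group = quasi_garside_group +
  fixes deg :: "'a \<Rightarrow> int"
  assumes deg_mult: "\<lbrakk>x \<in> carrier G; y \<in> carrier G\<rbrakk> \<Longrightarrow> deg (x \<otimes> y) = deg x + deg y"
    and deg_pos: "p \<in> P \<Longrightarrow> 0 \<le> deg p"
    and deg_Delta: "deg \<Delta> = 1"
begin

section \<open>The degree and the extremal values on a conjugacy class\<close>

lemma deg_one: "deg \<one> = 0"
  using deg_mult[of \<one> \<one>] by simp

lemma deg_inv: "x \<in> carrier G \<Longrightarrow> deg (inv x) = - deg x"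
  using deg_mult[of x "inv x"] by (simp add: deg_one)

lemma deg_Delta_nat_pow: "deg (\<Delta> [^] (m::nat)) = int m"
  by (induction m) (auto simp: deg_one deg_mult deg_Delta)

lemma deg_Delta_pow: "deg (\<Delta> [^] (r::int)) = r"
  by (cases r) (simp_all only: int_pow_int int_pow_neg_int deg_inv deg_Delta_nat_pow
      Delta_carrier nat_pow_closed)

lemma deg_conj: "\<lbrakk>x \<in> carrier G; g \<in> carrier G\<rbrakk> \<Longrightarrow> deg (inv x \<otimes> g \<otimes> x) = deg g"
  by (simp add: deg_mult deg_inv)

lemma deg_le: "\<lbrakk>x \<preceq> y; x \<in> carrier G\<rbrakk> \<Longrightarrow> deg x \<le> deg y"
  unfolding le_left_def using deg_mult deg_pos by fastforce

lemma not_Delta_le_one: "\<not> \<Delta> \<preceq> \<one>"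
  using deg_le[of \<Delta> \<one>] by (auto simp: deg_one deg_Delta)

text \<open>Some power lies below \<open>g\<close> and the degree of \<open>g\<close> bounds the
  exponents, so the maximum is attained; smaller exponents follow by monotonicity of the
  powers.\<close>

lemma Delta_pow_le_iff:
  assumes g: "g \<in> carrier G"
  shows "\<Delta> [^] (r::int) \<preceq> g \<longleftrightarrow> r \<le> garside_inf G P \<Delta> g"
proof -
  obtain a :: int where a: "\<Delta> [^] a \<preceq> g"
    using Delta_pow_below[OF g] by blast
  have b: "r \<le> deg g" if "\<Delta> [^] r \<preceq> g" for r :: int
    using deg_le[OF that] by (simp add: deg_Delta_pow)
  have "\<Delta> [^] garside_inf G P \<Delta> g \<preceq> g" "\<Delta> [^] r \<preceq> g \<Longrightarrow> r \<le> garside_inf G P \<Delta> g"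
    unfolding garside_inf_def
    using int_Greatest_bounded[of "\<lambda>r. \<Delta> [^] r \<preceq> g", OF a b] by auto
  then show ?thesis
    using le_trans[OF Delta_pow_mono] by blast
qed

lemma le_Delta_pow_iff:
  assumes g: "g \<in> carrier G"
  shows "g \<preceq> \<Delta> [^] (s::int) \<longleftrightarrow> garside_sup G P \<Delta> g \<le> s"
proof -
  obtain a :: int where a: "g \<preceq> \<Delta> [^] a"
    using Delta_pow_above[OF g] by blast
  have b: "deg g \<le> s" if "g \<preceq> \<Delta> [^] s" for s :: int
    using deg_le[OF that g] by (simp add: deg_Delta_pow)
  have "g \<preceq> \<Delta> [^] garside_sup G P \<Delta> g" "g \<preceq> \<Delta> [^] s \<Longrightarrow> garside_sup G P \<Delta> g \<le> s"
    unfolding garside_sup_def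
    using int_Least_bounded[of "\<lambda>s. g \<preceq> \<Delta> [^] s", OF a b] by auto
  then show ?thesis
    using le_trans[OF _ Delta_pow_mono g] by blast
qed

lemma garside_inf_le_deg: "g \<in> carrier G \<Longrightarrow> garside_inf G P \<Delta> g \<le> deg g"
  using deg_le[of "\<Delta> [^] garside_inf G P \<Delta> g" g] by (simp add: Delta_pow_le_iff deg_Delta_pow)

lemma deg_le_garside_sup: "g \<in> carrier G \<Longrightarrow> deg g \<le> garside_sup G P \<Delta> g"
  using deg_le[of g "\<Delta> [^] garside_sup G P \<Delta> g"] by (simp add: le_Delta_pow_iff deg_Delta_pow)

lemma deg_conj_class: "\<lbrakk>h \<in> conj_class G g; g \<in> carrier G\<rbrakk> \<Longrightarrow> deg h = deg g"
  by (auto simp: conj_class_def deg_conj)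

text \<open>The degree is constant on the class and bounds every infimum there, so the maximum is
  attained by some conjugate, whose conjugator is the required transporter.\<close>

lemma
  assumes g: "g \<in> carrier G"
  shows summit_inf_attained: "\<exists>x. x \<in> inf_transporters g (summit_inf G P \<Delta> g)"
    and summit_inf_upper: "h \<in> conj_class G g \<Longrightarrow> garside_inf G P \<Delta> h \<le> summit_inf G P \<Delta> g"
proof -
  let ?Q = "\<lambda>r. r \<in> garside_inf G P \<Delta> ` conj_class G g"
  have b: "r \<le> deg g" if "?Q r" for r
    using that g garside_inf_le_deg deg_conj_class conj_class_carrier by (metis imageE)
  have a: "?Q (garside_inf G P \<Delta> g)"
    using conj_class_self[OF g] by simp
  have "?Q (summit_inf G P \<Delta> g)"
    unfolding summit_inf_def by (rule int_Greatest_bounded(1)[of ?Q, OF a b])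
  then obtain x where "x \<in> carrier G" "summit_inf G P \<Delta> g = garside_inf G P \<Delta> (inv x \<otimes> g \<otimes> x)"
    by (auto simp: conj_class_def)
  then show "\<exists>x. x \<in> inf_transporters g (summit_inf G P \<Delta> g)"
    using g by (auto simp: inf_transporters_iff Delta_pow_le_iff intro!: exI[of _ x])
  show "h \<in> conj_class G g \<Longrightarrow> garside_inf G P \<Delta> h \<le> summit_inf G P \<Delta> g"
    unfolding summit_inf_def by (rule int_Greatest_bounded(2)[of ?Q, OF a b]) auto
qed

lemma
  assumes g: "g \<in> carrier G"
  shows summit_sup_attained: "\<exists>x. x \<in> sup_transporters g (summit_sup G P \<Delta> g)"
    and summit_sup_lower: "h \<in> conj_class G g \<Longrightarrow> summit_sup G P \<Delta> g \<le> garside_sup G P \<Delta> h"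
proof -
  let ?Q = "\<lambda>r. r \<in> garside_sup G P \<Delta> ` conj_class G g"
  have b: "deg g \<le> r" if "?Q r" for r
    using that g deg_le_garside_sup deg_conj_class conj_class_carrier by (metis imageE)
  have a: "?Q (garside_sup G P \<Delta> g)"
    using conj_class_self[OF g] by simp
  have "?Q (summit_sup G P \<Delta> g)"
    unfolding summit_sup_def by (rule int_Least_bounded(1)[of ?Q, OF a b])
  then obtain x where "x \<in> carrier G" "summit_sup G P \<Delta> g = garside_sup G P \<Delta> (inv x \<otimes> g \<otimes> x)"
    by (auto simp: conj_class_def)
  then show "\<exists>x. x \<in> sup_transporters g (summit_sup G P \<Delta> g)"
    using g by (auto simp: sup_transporters_iff le_Delta_pow_iff intro!: exI[of _ x])
  show "h \<in> conj_class G g \<Longrightarrow> summit_sup G P \<Delta> g \<le> garside_sup G P \<Delta> h"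
    unfolding summit_sup_def by (rule int_Least_bounded(2)[of ?Q, OF a b]) auto
qed

text \<open>The summit values are extremal on the class, so the two equalities amount to
  inequalities, and these are the transporter conditions.\<close>

lemma super_summit_iff:
  assumes g: "g \<in> carrier G" and x: "x \<in> carrier G"
  shows "inv x \<otimes> g \<otimes> x \<in> super_summit_set G P \<Delta> g \<longleftrightarrow>
    x \<in> inf_transporters g (summit_inf G P \<Delta> g) \<inter> sup_transporters g (summit_sup G P \<Delta> g)"
proof -
  have h: "inv x \<otimes> g \<otimes> x \<in> conj_class G g"
    using x by (auto simp: conj_class_def)
  show ?thesis
    using g x h summit_inf_upper[OF g h] summit_sup_lower[OF g h]
    by (auto simp: super_summit_set_def inf_transporters_iff sup_transporters_iff Delta_pow_le_iff
        le_Delta_pow_iff)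
qed

lemma super_summit_carrier:
  "\<lbrakk>g \<in> carrier G; h \<in> super_summit_set G P \<Delta> g\<rbrakk> \<Longrightarrow> h \<in> carrier G"
  by (auto simp: super_summit_set_def conj_class_def)

text \<open>Prescribed infimum and supremum confine the set to an interval between two powers of
  \<Delta>.\<close>

lemma finite_super_summit_set:
  assumes g: "g \<in> carrier G"
  shows "finite (super_summit_set G P \<Delta> g)"
proof -
  have "super_summit_set G P \<Delta> g \<subseteq> {h \<in> carrier G.
      \<Delta> [^] summit_inf G P \<Delta> g \<preceq> h \<and> h \<preceq> \<Delta> [^] summit_sup G P \<Delta> g}"
  proof
    fix h assume h: "h \<in> super_summit_set G P \<Delta> g"
    then have "h \<in> carrier G"
      using g by (rule super_summit_carrier[rotated])
    then show "h \<in> {h \<in> carrier G.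
        \<Delta> [^] summit_inf G P \<Delta> g \<preceq> h \<and> h \<preceq> \<Delta> [^] summit_sup G P \<Delta> g}"
      using h by (simp add: super_summit_set_def Delta_pow_le_iff le_Delta_pow_iff)
  qed
  then show ?thesis
    using finite_interval[of "\<Delta> [^] summit_inf G P \<Delta> g" "\<Delta> [^] summit_sup G P \<Delta> g"]
    by (simp add: finite_subset)
qed

section \<open>Existence and uniqueness of normal forms\<close>

definition normal_word :: "'a list \<Rightarrow> bool" where
  "normal_word ss \<longleftrightarrow> set ss \<subseteq> left_divisors G P \<Delta> - {\<one>, \<Delta>} \<and>
     (\<forall>i < length ss. list_prod G (drop i ss) \<curlywedge> \<Delta> = ss ! i)"

lemma is_normal_form_iff:
  "is_normal_form G P \<Delta> g r ss \<longleftrightarrow> g = \<Delta> [^] r \<otimes> list_prod G ss \<and> normal_word ss"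
  by (simp add: is_normal_form_def normal_word_def)

lemma normal_word_Nil [simp]: "normal_word []"
  by (simp add: normal_word_def)

lemma normal_word_Cons [simp]:
  "normal_word (s # ss) \<longleftrightarrow> s \<in> left_divisors G P \<Delta> - {\<one>, \<Delta>} \<and>
     (s \<otimes> list_prod G ss) \<curlywedge> \<Delta> = s \<and> normal_word ss"
  unfolding normal_word_def by (auto simp: All_less_Suc2)

lemma left_divisors_Delta_pos: "s \<in> left_divisors G P \<Delta> \<Longrightarrow> s \<in> P"
  by (simp add: left_divisors_def)

lemma list_prod_pos: "set ss \<subseteq> P \<Longrightarrow> list_prod G ss \<in> P"
  by (induction ss) auto

lemma normal_word_pos: "normal_word ss \<Longrightarrow> list_prod G ss \<in> P"
  by (rule list_prod_pos) (auto simp: normal_word_def left_divisors_def)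

text \<open>Otherwise the meet of the product with \<Delta> would be \<Delta>, whereas it is the
  first letter. The empty word is excluded by degree.\<close>

lemma not_Delta_le_normal_word:
  assumes "normal_word ss"
  shows "\<not> \<Delta> \<preceq> list_prod G ss"
proof (cases ss)
  case Nil
  then show ?thesis
    by (simp add: not_Delta_le_one)
next
  case (Cons s ts)
  show ?thesis
  proof
    assume le: "\<Delta> \<preceq> list_prod G ss"
    have "list_prod G ss \<in> carrier G"
      using assms normal_word_pos by blast
    then have "list_prod G ss \<curlywedge> \<Delta> = \<Delta>"
      using le by (intro meet_eqI) auto
    moreover have "list_prod G ss \<curlywedge> \<Delta> = s" "s \<noteq> \<Delta>"
      using assms Cons by auto
    ultimately show False
      by simp
  qed
qed

text \<open>The first letter is recovered as the meet of the product with \<Delta>, and can then be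
  cancelled.\<close>

lemma normal_word_unique:
  assumes "normal_word ss" "normal_word ts" "list_prod G ss = list_prod G ts"
  shows "ss = ts"
  using assms
proof (induction ss arbitrary: ts)
  case Nil
  show ?case
  proof (cases ts)
    case (Cons t us)
    \<comment> \<open>A nonempty word with product \<open>\<one>\<close> would have this meet as its
      first letter, but \<open>\<one>\<close> is excluded as a letter.\<close>
    have "\<one> \<curlywedge> \<Delta> = \<one>"
      using Delta_pos by (intro meet_eqI) (auto simp: one_le_iff)
    then show ?thesis
      using Nil Cons by auto
  qed simp
next
  case (Cons s ss)
  show ?case
  proof (cases ts)
    case Nil
    have "\<one> \<curlywedge> \<Delta> = \<one>"
      using Delta_pos by (intro meet_eqI) (auto simp: one_le_iff)
    then show ?thesis
      using Nil Cons by auto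
  next
    case (Cons t us)
    have st: "s = t"
      using Cons Cons.prems by auto
    have c: "t \<in> carrier G" "list_prod G ss \<in> carrier G" "list_prod G us \<in> carrier G"
      using Cons Cons.prems normal_word_pos left_divisors_Delta_pos by auto
    then have "list_prod G ss = list_prod G us"
      using st Cons Cons.prems by simp
    then show ?thesis
      using st Cons Cons.prems Cons.IH by simp
  qed
qed

text \<open>Greedy factorization: split off \<open>?s = p \<curlywedge> \<Delta>\<close>. The
  remainder \<open>q\<close> divides one power of \<Delta> less, which drives the induction.\<close>

lemma ex_normal_word:
  assumes "p \<in> P" "\<not> \<Delta> \<preceq> p" "p \<preceq> \<Delta> [^] (m::nat)"
  shows "\<exists>ss. normal_word ss \<and> list_prod G ss = p"
  using assms
proof (induction m arbitrary: p)
  case 0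
  then have "p = \<one>"
    using le_antisym[of p \<one>] by (simp add: one_le_iff)
  then show ?case
    by (intro exI[of _ "[]"]) simp
next
  case (Suc m)
  show ?case
  proof (cases "p = \<one>")
    case True
    then show ?thesis
      by (intro exI[of _ "[]"]) simp
  next
    case False
    let ?s = "p \<curlywedge> \<Delta>"
    define q where "q = inv ?s \<otimes> p"
    have pc: "p \<in> carrier G"
      using Suc.prems by blast
    have s: "?s \<in> P" "?s \<preceq> \<Delta>" "?s \<preceq> p" "?s \<noteq> \<one>"
      using meet_pos[OF Suc.prems(1) Delta_pos] meet_le1[OF pc] meet_le2[OF pc]
        meet_Delta_eq_one[OF Suc.prems(1)] False by auto
    \<comment> \<open>\<open>?s = \<Delta>\<close> would put \<Delta> below \<open>p\<close>, and
      \<open>?s = \<one>\<close> would force \<open>p = \<one>\<close> by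
      \<open>meet_Delta_eq_one\<close>.\<close>
    then have sD: "?s \<in> left_divisors G P \<Delta> - {\<one>, \<Delta>}"
      using Suc.prems(2) by (auto simp: left_divisors_def)
    have q: "q \<in> P"
      using s pc by (simp add: q_def le_iff[of ?s p])
    have sq: "?s \<otimes> q = p"
      using pc by (simp add: q_def m_assoc[symmetric])
    \<comment> \<open>A factor \<Delta> at the front of \<open>q\<close> could be moved past
      \<open>?s\<close> to the front of \<open>p\<close>.\<close>
    have "\<not> \<Delta> \<preceq> q"
    proof
      assume "\<Delta> \<preceq> q"
      then obtain c where c: "c \<in> P" "\<Delta> \<otimes> c = q"
        unfolding le_left_def by blast
      obtain t where t: "t \<in> P" "?s \<otimes> \<Delta> = \<Delta> \<otimes> t"
        using Delta_right s(1) by blast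
      have "p = ?s \<otimes> \<Delta> \<otimes> c"
        using c pc sq by (simp add: m_assoc)
      also have "\<dots> = \<Delta> \<otimes> (t \<otimes> c)"
        using c t by (simp add: m_assoc)
      finally show False
        using Suc.prems(2) le_mult_pos[of \<Delta> "t \<otimes> c"] c t by simp
    qed
    \<comment> \<open>\<open>p\<close> lies below both \<open>p \<otimes> \<Delta> [^] m\<close> and
      \<open>\<Delta> [^] Suc m\<close>, whose meet is \<open>?s \<otimes> \<Delta> [^] m\<close>;
      then \<open>?s\<close> cancels.\<close>
    moreover have "q \<preceq> \<Delta> [^] m"
    proof -
      have "p \<preceq> p \<otimes> \<Delta> [^] m" "p \<preceq> \<Delta> \<otimes> \<Delta> [^] m"
        using pc le_mult_pos Suc.prems(3) nat_pow_Suc2[of \<Delta> m] by auto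
      then have "p \<preceq> ?s \<otimes> \<Delta> [^] m"
        using pc meet_greatest[of "p \<otimes> \<Delta> [^] m" "\<Delta> \<otimes> \<Delta> [^] m" p]
          meet_mult_Delta_pow[of p \<Delta> "int m"] by (simp add: int_pow_int)
      then have "?s \<otimes> q \<preceq> ?s \<otimes> \<Delta> [^] m"
        by (simp only: sq)
      then show ?thesis
        using pc q by simp
    qed
    ultimately obtain ss where "normal_word ss" "list_prod G ss = q"
      using Suc.IH q by blast
    then show ?thesis
      using sD sq by (intro exI[of _ "?s # ss"]) simp
  qed
qed

text \<open>With the infimum as exponent, its maximality keeps \<Delta> from dividing the positive
  remainder.\<close>

lemma ex_normal_form:
  assumes g: "g \<in> carrier G"
  shows "\<exists>r ss. is_normal_form G P \<Delta> g r ss"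
proof -
  let ?r = "garside_inf G P \<Delta> g"
  define p where "p = inv (\<Delta> [^] ?r) \<otimes> g"
  have gp: "g = \<Delta> [^] ?r \<otimes> p" and p: "p \<in> P"
    using g Delta_pow_le_iff[OF g, of ?r] by (auto simp: p_def m_assoc[symmetric] le_iff)
  have "\<not> \<Delta> \<preceq> p"
  proof
    assume "\<Delta> \<preceq> p"
    then have "\<Delta> [^] ?r \<otimes> \<Delta> [^] (1::int) \<preceq> g"
      by (subst gp) (simp add: p)
    then have "\<Delta> [^] (?r + 1) \<preceq> g"
      by (simp only: int_pow_mult Delta_carrier)
    then show False
      using Delta_pow_le_iff[OF g] by simp
  qed
  moreover obtain m :: nat where "p \<preceq> \<Delta> [^] m"
    using Delta_cofinal p by blast
  ultimately show ?thesis
    using gp p ex_normal_word unfolding is_normal_form_iff by metis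
qed

text \<open>If one exponent were larger, \<Delta> would divide the normal word attached to the
  smaller one. With equal exponents the words have equal products.\<close>

lemma normal_form_unique:
  assumes "is_normal_form G P \<Delta> g r ss" "is_normal_form G P \<Delta> g t ts"
  shows "r = t \<and> ss = ts"
proof -
  have le: "b \<le> a"
    if "is_normal_form G P \<Delta> g a us" "is_normal_form G P \<Delta> g b vs" for a b us vs
  proof (rule ccontr)
    assume "\<not> b \<le> a"
    then have ab: "a + 1 \<le> b"
      by simp
    have u: "normal_word us" "list_prod G us \<in> P" "list_prod G vs \<in> P"
      and eq: "\<Delta> [^] b \<otimes> list_prod G vs = \<Delta> [^] a \<otimes> list_prod G us"
      using that normal_word_pos by (auto simp: is_normal_form_iff)
    have "\<Delta> [^] (a + 1) \<preceq> \<Delta> [^] a \<otimes> list_prod G us"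
      using le_trans[OF Delta_pow_mono[OF ab]] le_mult_pos[of "\<Delta> [^] b" "list_prod G vs"] u eq
      by simp
    then have "\<Delta> [^] a \<otimes> \<Delta> \<preceq> \<Delta> [^] a \<otimes> list_prod G us"
      using int_pow_mult[of \<Delta> a 1] by simp
    then show False
      using u not_Delta_le_normal_word by simp
  qed
  have "r = t"
    using le[OF assms] le[OF assms(2,1)] by simp
  moreover have "list_prod G ss \<in> carrier G" "list_prod G ts \<in> carrier G"
    using assms normal_word_pos by (auto simp: is_normal_form_iff)
  ultimately show ?thesis
    using assms by (auto simp: is_normal_form_iff intro: normal_word_unique)
qed

text \<open>Cycling is conjugation by \<open>a\<close>, the image of the first letter
  \<open>s\<close> under the power -r of \<tau>. Conjugating the identity for \<open>s\<close> by
  \<open>\<Delta> [^] r\<close> displays \<open>a\<close> as a meet of elements built from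
  \<open>h\<close> and \<Delta>, so results about meets apply to it.\<close>

lemma cycling_eq:
  assumes h: "h \<in> carrier G"
  shows "cycling G P \<Delta> h = h \<or>
    (\<exists>r::int. cycling G P \<Delta> h = inv (h \<otimes> \<Delta> [^] (- r) \<curlywedge> \<Delta>) \<otimes> h \<otimes> (h \<otimes> \<Delta> [^] (- r) \<curlywedge> \<Delta>))"
proof -
  obtain r ss where nf: "is_normal_form G P \<Delta> h r ss"
    using ex_normal_form[OF h] by blast
  have the: "(THE (r, ss). is_normal_form G P \<Delta> h r ss) = (r, ss)"
  proof (rule the_equality)
    show "p = (r, ss)" if "case p of (r, ss) \<Rightarrow> is_normal_form G P \<Delta> h r ss" for p
      using that normal_form_unique[OF nf, of "fst p" "snd p"] by (cases p) simp
  qed (use nf in simp)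
  show ?thesis
  proof (cases ss)
    case Nil
    then show ?thesis
      unfolding cycling_def the by simp
  next
    case (Cons s ts)
    let ?D = "\<Delta> [^] r" and ?E = "\<Delta> [^] (- r)" and ?t = "list_prod G ts"
    have s: "s \<in> carrier G" and t: "?t \<in> carrier G" and hs: "h = ?D \<otimes> (s \<otimes> ?t)"
      and meet: "(s \<otimes> ?t) \<curlywedge> \<Delta> = s"
      using nf Cons normal_word_pos left_divisors_Delta_pos by (auto simp: is_normal_form_iff)
    have E: "?E = inv ?D"
      by (simp add: int_pow_neg)
    define a where "a = ?D \<otimes> s \<otimes> ?E"
    have ac: "a \<in> carrier G"
      using s by (simp add: a_def)
    have "?D \<otimes> (s \<otimes> ?t) \<otimes> ?E \<curlywedge> ?D \<otimes> \<Delta> \<otimes> ?E = (?D \<otimes> (s \<otimes> ?t) \<curlywedge> ?D \<otimes> \<Delta>) \<otimes> ?E"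
      using s t by (intro meet_mult_Delta_pow) auto
    moreover have "?D \<otimes> (s \<otimes> ?t) \<curlywedge> ?D \<otimes> \<Delta> = ?D \<otimes> ((s \<otimes> ?t) \<curlywedge> \<Delta>)"
      using s t by (intro meet_mult_left) auto
    moreover have "?D \<otimes> \<Delta> \<otimes> ?E = \<Delta>"
      using Delta_pow_commute[of r 1] by (simp add: E m_assoc)
    ultimately have a: "h \<otimes> ?E \<curlywedge> \<Delta> = a"
      by (simp add: hs meet a_def)
    \<comment> \<open>Since \<open>a \<otimes> ?D = ?D \<otimes> s\<close>, the first three factors
      multiply to \<open>h\<close>.\<close>
    have "a \<otimes> (?D \<otimes> ?t \<otimes> a) = h \<otimes> a"
      using s t ac by (simp add: a_def E hs m_assoc) (simp add: m_assoc[symmetric])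
    then have "inv a \<otimes> h \<otimes> a = ?D \<otimes> ?t \<otimes> a"
      using s t ac h by (simp add: m_assoc inv_solve_left')
    moreover have "cycling G P \<Delta> h = ?D \<otimes> ?t \<otimes> a"
      unfolding cycling_def the by (simp add: Cons tau_pow_def a_def)
    ultimately have "cycling G P \<Delta> h = inv a \<otimes> h \<otimes> a"
      by simp
    then show ?thesis
      unfolding a[symmetric] by blast
  qed
qed

text \<open>For \<open>h\<close> in the super summit set, \<open>\<one>\<close> is a transporter of
  \<open>h\<close> for both bounds. Hence so are \<open>h \<otimes> \<Delta> [^] k\<close> and
  \<Delta>, and so is their meet \<open>a\<close>, the cycling conjugator.\<close>

lemma cycling_super_summit:
  assumes g: "g \<in> carrier G" and h: "h \<in> super_summit_set G P \<Delta> g"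
  shows "cycling G P \<Delta> h \<in> super_summit_set G P \<Delta> g"
proof -
  let ?r = "summit_inf G P \<Delta> g" and ?s = "summit_sup G P \<Delta> g"
  have hc: "h \<in> carrier G"
    using super_summit_carrier[OF g h] .
  obtain x where x: "x \<in> carrier G" "h = inv x \<otimes> g \<otimes> x"
    using h by (auto simp: super_summit_set_def conj_class_def)
  have one: "\<one> \<in> inf_transporters h ?r" "\<one> \<in> sup_transporters h ?s"
    using h hc by (auto simp: inf_transporters_iff sup_transporters_iff Delta_pow_le_iff
        le_Delta_pow_iff super_summit_set_def)
  consider "cycling G P \<Delta> h = h"
    | k :: int where "cycling G P \<Delta> h = inv (h \<otimes> \<Delta> [^] k \<curlywedge> \<Delta>) \<otimes> h \<otimes> (h \<otimes> \<Delta> [^] k \<curlywedge> \<Delta>)"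
    using cycling_eq[OF hc] by blast
  then show ?thesis
  proof cases
    case 2
    define a where "a = h \<otimes> \<Delta> [^] k \<curlywedge> \<Delta>"
    have ac: "a \<in> carrier G"
      using hc by (simp add: a_def)
    have "h \<otimes> (\<one> \<otimes> \<Delta> [^] k) \<in> inf_transporters h ?r" "h \<otimes> (\<one> \<otimes> \<Delta> [^] k) \<in> sup_transporters h ?s"
      "\<one> \<otimes> \<Delta> [^] (1::int) \<in> inf_transporters h ?r" "\<one> \<otimes> \<Delta> [^] (1::int) \<in> sup_transporters h ?s"
      using hc one inf_transporters_mult_Delta_pow sup_transporters_mult_Delta_pow
        inf_transporters_centralizer sup_transporters_centralizer by blast+
    then have a: "a \<in> inf_transporters h ?r" "a \<in> sup_transporters h ?s"
      using hc meet_inf_transporters[OF hc] meet_sup_transporters[OF hc] by (simp_all add: a_def)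
    have eq: "inv a \<otimes> h \<otimes> a = inv (x \<otimes> a) \<otimes> g \<otimes> (x \<otimes> a)"
      using x ac g by (simp add: inv_mult_group m_assoc)
    have "x \<otimes> a \<in> inf_transporters g ?r \<inter> sup_transporters g ?s"
      using a ac hc g x eq[symmetric] by (simp add: inf_transporters_iff sup_transporters_iff)
    then have "inv (x \<otimes> a) \<otimes> g \<otimes> (x \<otimes> a) \<in> super_summit_set G P \<Delta> g"
      using super_summit_iff[OF g] x ac by blast
    then show ?thesis
      using 2 eq by (simp add: a_def)
  qed (use h in simp)
qed

lemma cycling_commute_normalizer:
  assumes z: "z \<in> order_normalizer" and h: "h \<in> carrier G" and zh: "z \<otimes> h = h \<otimes> z"
  shows "z \<otimes> cycling G P \<Delta> h = cycling G P \<Delta> h \<otimes> z"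
proof -
  have zc: "z \<in> carrier G" and zD: "z \<otimes> \<Delta> = \<Delta> \<otimes> z"
    using z by (auto simp: order_normalizer_def)
  consider "cycling G P \<Delta> h = h"
    | k :: int where "cycling G P \<Delta> h = inv (h \<otimes> \<Delta> [^] k \<curlywedge> \<Delta>) \<otimes> h \<otimes> (h \<otimes> \<Delta> [^] k \<curlywedge> \<Delta>)"
    using cycling_eq[OF h] by blast
  then show ?thesis
  proof cases
    case 2
    define a where "a = h \<otimes> \<Delta> [^] k \<curlywedge> \<Delta>"
    have ac: "a \<in> carrier G"
      using h by (simp add: a_def)
    have za: "z \<otimes> a = a \<otimes> z"
      unfolding a_def using h zc zD
      by (intro meet_commute_normalizer[OF z] commute_mult[OF zh] int_pow_commute) auto
    have "z \<otimes> inv a = inv a \<otimes> z"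
      using inv_commute[OF za[symmetric] ac zc] by simp
    then have "z \<otimes> (inv a \<otimes> h \<otimes> a) = inv a \<otimes> h \<otimes> a \<otimes> z"
      using za zh ac h zc by (intro commute_mult) auto
    then show ?thesis
      using 2 by (simp add: a_def)
  qed (use zh in simp)
qed

lemma ex_ultra_summit_commuting:
  assumes z: "z \<in> order_normalizer" and g: "g \<in> carrier G" and zg: "z \<otimes> g = g \<otimes> z"
  shows "\<exists>h \<in> ultra_summit_set G P \<Delta> g. z \<otimes> h = h \<otimes> z"
proof -
  let ?r = "summit_inf G P \<Delta> g" and ?s = "summit_sup G P \<Delta> g" and ?c = "cycling G P \<Delta>"
  have zc: "z \<in> carrier G"
    using z by (simp add: order_normalizer_def)
  obtain y where "y \<in> inf_transporters g ?r \<inter> sup_transporters g ?s"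
    using inf_sup_transporters_nonempty[OF g] summit_inf_attained[OF g] summit_sup_attained[OF g]
    by blast
  then obtain x where x: "x \<in> inf_transporters g ?r \<inter> sup_transporters g ?s"
    and zx: "z \<otimes> x = x \<otimes> z"
    using ex_commuting_transporter[OF z g zg] by blast
  have xc: "x \<in> carrier G"
    using x by (simp add: inf_transporters_def)
  define h where "h = inv x \<otimes> g \<otimes> x"
  have "z \<otimes> inv x = inv x \<otimes> z"
    using inv_commute[OF zx[symmetric] xc zc] by simp
  then have zh: "z \<otimes> h = h \<otimes> z"
    unfolding h_def using zg zx zc g xc commute_mult by simp
  define T where "T = {k \<in> super_summit_set G P \<Delta> g. z \<otimes> k = k \<otimes> z}"
  have "h \<in> T"
    using super_summit_iff[OF g xc] x zh by (simp add: T_def h_def)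
  then have iter: "(?c ^^ i) h \<in> T" for i
    using cycling_super_summit[OF g] cycling_commute_normalizer[OF z] super_summit_carrier[OF g]
    by (induction i) (auto simp: T_def)
  have "finite T"
    using finite_super_summit_set[OF g] by (simp add: T_def)
  then have "finite (range (\<lambda>i. (?c ^^ i) h))"
    using iter by (auto intro: finite_subset)
  \<comment> \<open>All iterates lie in the finite set \<open>T\<close>, so two of them
    coincide.\<close>
  then have "\<not> inj (\<lambda>i. (?c ^^ i) h)"
    using finite_imageD infinite_UNIV_nat by blast
  then obtain i j where "i \<noteq> j" "(?c ^^ i) h = (?c ^^ j) h"
    by (auto simp: inj_def)
  then obtain i j where ij: "i < j" "(?c ^^ i) h = (?c ^^ j) h"
    by (metis linorder_neqE_nat)
  have "(?c ^^ (j - i)) ((?c ^^ i) h) = (?c ^^ (j - i + i)) h"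
    by (simp add: funpow_add)
  then have "(?c ^^ (j - i)) ((?c ^^ i) h) = (?c ^^ i) h"
    using ij by simp
  \<comment> \<open>The sequence may have a preperiod, so the element taken is the iterate at
    \<open>i\<close>; cycling it \<open>j - i\<close> times returns it.\<close>
  then have "(?c ^^ i) h \<in> ultra_summit_set G P \<Delta> g"
    using iter[of i] ij unfolding ultra_summit_set_def T_def by (auto intro!: exI[of _ "j - i"])
  then show ?thesis
    using iter[of i] by (auto simp: T_def)
qed

end

section \<open>Garside groups are quasi-Garside\<close>

context garside_group
begin

abbreviation pos_monoid where "pos_monoid \<equiv> G\<lparr>carrier := P\<rparr>"

text \<open>Every generating set contains all atoms: a product that is an atom must equal one of its
  factors.\<close>

lemma finite_atoms: "finite (atoms pos_monoid)"
proof -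
  interpret M: garside_monoid pos_monoid \<Delta>
    by (rule positive_garside)
  obtain S where S: "finite S" "S \<subseteq> P" "monoid_generated pos_monoid S = P"
    using M.finitely_generated by auto
  have closed: "list_prod pos_monoid xs \<in> P" if "set xs \<subseteq> S" for xs
    using that S(2) M.m_closed M.one_closed by (induction xs) (auto simp: list_prod_def)
  have mem: "list_prod pos_monoid xs \<in> set xs"
    if "set xs \<subseteq> S" "list_prod pos_monoid xs \<in> atoms pos_monoid" for xs
    using that
  proof (induction xs)
    case Nil
    then show ?case
      by (simp add: list_prod_def atoms_def)
  next
    case (Cons x xs)
    let ?p = "list_prod pos_monoid xs"
    have eq: "list_prod pos_monoid (x # xs) = x \<otimes> ?p"
      by (simp add: list_prod_def)
    have xp: "x \<in> P" "?p \<in> P"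
      using Cons.prems S(2) closed by auto
    then have "x = \<one> \<or> ?p = \<one>"
      using Cons.prems(2) eq unfolding atoms_def by auto
    moreover have "x \<in> carrier G" "?p \<in> carrier G"
      using xp submonoid.subset[OF positive_submonoid] by auto
    ultimately show ?case
      using Cons eq by auto
  qed
  have "atoms pos_monoid \<subseteq> S"
  proof
    fix a assume a: "a \<in> atoms pos_monoid"
    then have "a \<in> monoid_generated pos_monoid S"
      using S(3) by (simp add: atoms_def)
    then obtain xs where "set xs \<subseteq> S" "a = list_prod pos_monoid xs"
      by (auto simp: monoid_generated_def)
    then show "a \<in> S"
      using mem a by blast
  qed
  then show ?thesis
    using S(1) finite_subset by blast
qed

text \<open>Concatenating atom words for \<open>a\<close> and for its complement gives a word for
  \<open>b\<close>. So \<open>a\<close> is the product of at most \<open>N\<close> atoms, and there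
  are finitely many such words.\<close>

lemma finite_left_divisors:
  assumes b: "b \<in> P"
  shows "finite {a \<in> P. le_left G P a b}"
proof -
  interpret M: garside_monoid pos_monoid \<Delta>
    by (rule positive_garside)
  let ?A = "atoms pos_monoid"
  obtain N where N: "atom_norm pos_monoid b = enat N"
    using M.norm_finite[of b] b by auto
  have closed: "list_prod pos_monoid xs \<in> P" if "set xs \<subseteq> ?A" for xs
    using that M.m_closed M.one_closed by (induction xs) (auto simp: list_prod_def atoms_def)
  have sub: "P \<subseteq> carrier G"
    using submonoid.subset[OF positive_submonoid] .
  have app: "list_prod pos_monoid (xs @ ys) = list_prod pos_monoid xs \<otimes> list_prod pos_monoid ys"
    if "set xs \<subseteq> ?A" "set ys \<subseteq> ?A" for xs ys
    using that
  proof (induction xs)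
    case Nil
    have "list_prod pos_monoid ys \<in> carrier G"
      using closed[OF Nil(2)] sub by blast
    then show ?case
      by (simp add: list_prod_def)
  next
    case (Cons x xs)
    then have "x \<in> P" "list_prod pos_monoid xs \<in> P" "list_prod pos_monoid ys \<in> P"
      using closed by (auto simp: atoms_def)
    then show ?case
      using Cons sub by (simp add: list_prod_def m_assoc subset_iff)
  qed
  have gen: "\<exists>xs. set xs \<subseteq> ?A \<and> list_prod pos_monoid xs = a" if "a \<in> P" for a
  proof -
    have "a \<in> monoid_generated pos_monoid ?A"
      using that M.atoms_generate by simp
    then show ?thesis
      by (auto simp: monoid_generated_def)
  qed
  have "{a \<in> P. le_left G P a b} \<subseteq> list_prod pos_monoid ` {xs. set xs \<subseteq> ?A \<and> length xs \<le> N}"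
  proof
    fix a assume "a \<in> {a \<in> P. le_left G P a b}"
    then obtain c where c: "a \<in> P" "c \<in> P" "a \<otimes> c = b"
      by (auto simp: le_left_def)
    obtain xs ys where xs: "set xs \<subseteq> ?A" "list_prod pos_monoid xs = a"
      and ys: "set ys \<subseteq> ?A" "list_prod pos_monoid ys = c"
      using gen c by meson
    have "list_prod pos_monoid (xs @ ys) = b"
      using app xs ys c by simp
    then have "enat (length (xs @ ys)) \<le> atom_norm pos_monoid b"
      unfolding atom_norm_def using xs ys by (intro Sup_upper) (auto intro!: exI[of _ "xs @ ys"])
    then have "length xs \<le> N"
      using N by simp
    then show "a \<in> list_prod pos_monoid ` {xs. set xs \<subseteq> ?A \<and> length xs \<le> N}"
      using xs by blast
  qed
  then show ?thesis
    using finite_lists_length_le[OF finite_atoms, of N] finite_subset by blast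
qed

text \<open>Induction along an expression of \<open>p\<close> as a product of simple
  elements.\<close>

lemma pos_induct [consumes 1, case_names one mult]:
  assumes "p \<in> P" and one: "Q \<one>"
    and mult: "\<And>s p. \<lbrakk>s \<in> left_divisors G P \<Delta>; p \<in> P; Q p\<rbrakk> \<Longrightarrow> Q (s \<otimes> p)"
  shows "Q p"
proof -
  interpret M: garside_monoid pos_monoid \<Delta>
    by (rule positive_garside)
  have D: "left_divisors pos_monoid P \<Delta> = left_divisors G P \<Delta>"
    by (simp add: left_divisors_def le_left_def)
  have "p \<in> monoid_generated pos_monoid (left_divisors G P \<Delta>)"
    using M.Delta_generates assms(1) D by simp
  then obtain xs where xs: "set xs \<subseteq> left_divisors G P \<Delta>" "p = list_prod pos_monoid xs"
    by (auto simp: monoid_generated_def)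
  have "list_prod pos_monoid xs \<in> P \<and> Q (list_prod pos_monoid xs)"
    using xs(1)
  proof (induction xs)
    case Nil
    then show ?case
      using one M.one_closed by (simp add: list_prod_def)
  next
    case (Cons x xs)
    then have "x \<in> P" "x \<in> left_divisors G P \<Delta>"
      by (auto simp: left_divisors_def)
    then show ?case
      using Cons mult M.m_closed by (simp add: list_prod_def)
  qed
  then show ?thesis
    using xs by simp
qed

lemma left_divisors_Delta_eq_right_divisors: "left_divisors G P \<Delta> = right_divisors G P \<Delta>"
  using garside_monoid.Delta_balanced[OF positive_garside]
  by (simp add: left_divisors_def right_divisors_def le_left_def le_right_def)

text \<open>The cofactor of \<open>s\<close> is a divisor of \<Delta> on the other side; since
  \<Delta> is balanced it is again simple, so complements can be iterated.\<close>

lemma simple_complements: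
  assumes s: "s \<in> left_divisors G P \<Delta>"
  shows "\<exists>t \<in> left_divisors G P \<Delta>. s \<otimes> t = \<Delta>" and "\<exists>t \<in> left_divisors G P \<Delta>. t \<otimes> s = \<Delta>"
proof -
  have sP: "s \<in> P"
    using s by (simp add: left_divisors_def)
  obtain t where t: "t \<in> P" "s \<otimes> t = \<Delta>"
    using s by (auto simp: left_divisors_def le_left_def)
  then have "t \<in> right_divisors G P \<Delta>"
    using sP by (auto simp: right_divisors_def le_right_def)
  then show "\<exists>t \<in> left_divisors G P \<Delta>. s \<otimes> t = \<Delta>"
    using t left_divisors_Delta_eq_right_divisors by blast
  obtain u where u: "u \<in> P" "u \<otimes> s = \<Delta>"
    using s unfolding left_divisors_Delta_eq_right_divisors
    by (auto simp: right_divisors_def le_right_def)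
  then have "u \<in> left_divisors G P \<Delta>"
    using sP by (auto simp: left_divisors_def le_left_def)
  then show "\<exists>t \<in> left_divisors G P \<Delta>. t \<otimes> s = \<Delta>"
    using u by blast
qed

lemma quasi_garside: "quasi_garside_group G P \<Delta>"
proof -
  interpret M: garside_monoid pos_monoid \<Delta>
    by (rule positive_garside)
  interpret L: lattice "left_order pos_monoid P"
    using M.left_lattice by simp
  have order: "left_order pos_monoid P = \<lparr>carrier = P, eq = (=), le = le_left G P\<rparr>"
    by (simp add: left_order_def le_left_def fun_eq_iff)
  have pos [simp]: "p \<in> carrier G" if "p \<in> P" for p
    using that submonoid.subset[OF positive_submonoid] by blast
  have one [simp]: "\<one> \<in> P"
    using submonoid.one_closed[OF positive_submonoid] .
  have mult [simp]: "p \<otimes> q \<in> P" if "p \<in> P" "q \<in> P" for p q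
    using submonoid.m_closed[OF positive_submonoid] that by blast
  have D [simp]: "\<Delta> \<in> P"
    using M.Delta_closed by simp
  have simple_pos: "s \<in> P" if "s \<in> left_divisors G P \<Delta>" for s
    using that by (simp add: left_divisors_def)
  have right: "\<exists>q \<in> P. p \<otimes> \<Delta> = \<Delta> \<otimes> q" if "p \<in> P" for p
    using that
  proof (induction rule: pos_induct)
    case one
    show ?case
      by (rule bexI[of _ \<one>]) auto
  next
    case (mult s p)
    then obtain q where q: "q \<in> P" "p \<otimes> \<Delta> = \<Delta> \<otimes> q"
      by blast
    \<comment> \<open>From \<open>s \<otimes> t = \<Delta> = t \<otimes> u\<close> follows \<open>s
      \<otimes> \<Delta> = s \<otimes> t \<otimes> u = \<Delta> \<otimes> u\<close>.\<close>
    obtain t where t: "t \<in> left_divisors G P \<Delta>" "s \<otimes> t = \<Delta>"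
      using simple_complements(1)[OF mult(1)] by blast
    obtain u where u: "u \<in> left_divisors G P \<Delta>" "t \<otimes> u = \<Delta>"
      using simple_complements(1)[OF t(1)] by blast
    have P: "s \<in> P" "t \<in> P" "u \<in> P"
      using mult t u simple_pos by auto
    have "s \<otimes> p \<otimes> \<Delta> = s \<otimes> \<Delta> \<otimes> q"
      using q mult(2) P by (simp add: m_assoc)
    also have "s \<otimes> \<Delta> = \<Delta> \<otimes> u"
      using P t(2) u(2) by (metis m_assoc pos)
    finally show ?case
      using P q by (intro bexI[of _ "u \<otimes> q"]) (auto simp: m_assoc)
  qed
  have left: "\<exists>q \<in> P. \<Delta> \<otimes> p = q \<otimes> \<Delta>" if "p \<in> P" for p
    using that
  proof (induction rule: pos_induct)
    case one
    show ?case
      by (rule bexI[of _ \<one>]) auto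
  next
    case (mult s p)
    then obtain q where q: "q \<in> P" "\<Delta> \<otimes> p = q \<otimes> \<Delta>"
      by blast
    obtain t where t: "t \<in> left_divisors G P \<Delta>" "t \<otimes> s = \<Delta>"
      using simple_complements(2)[OF mult(1)] by blast
    obtain u where u: "u \<in> left_divisors G P \<Delta>" "u \<otimes> t = \<Delta>"
      using simple_complements(2)[OF t(1)] by blast
    have P: "s \<in> P" "t \<in> P" "u \<in> P"
      using mult t u simple_pos by auto
    have "\<Delta> \<otimes> s = u \<otimes> \<Delta>"
      using P t(2) u(2) by (metis m_assoc pos)
    then have "\<Delta> \<otimes> (s \<otimes> p) = u \<otimes> \<Delta> \<otimes> p"
      using P mult(2) by (simp add: m_assoc[symmetric])
    also have "\<dots> = u \<otimes> q \<otimes> \<Delta>"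
      using q mult(2) P by (simp add: m_assoc)
    finally show ?case
      using P q by (intro bexI[of _ "u \<otimes> q"]) auto
  qed
  have Dpow [simp]: "\<Delta> [^] (m::nat) \<in> P" for m
    by (induction m) auto
  have right_pow: "\<exists>q \<in> P. p \<otimes> \<Delta> [^] m = \<Delta> [^] m \<otimes> q" if "p \<in> P" for p and m :: nat
    using that
  proof (induction m arbitrary: p)
    case 0
    then show ?case
      by auto
  next
    case (Suc m)
    obtain q where q: "q \<in> P" "p \<otimes> \<Delta> [^] m = \<Delta> [^] m \<otimes> q"
      using Suc by blast
    obtain t where t: "t \<in> P" "q \<otimes> \<Delta> = \<Delta> \<otimes> t"
      using right q by blast
    have "p \<otimes> \<Delta> [^] Suc m = \<Delta> [^] m \<otimes> q \<otimes> \<Delta>"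
      using q Suc.prems by (simp add: m_assoc[symmetric])
    also have "\<dots> = \<Delta> [^] Suc m \<otimes> t"
      using q t by (simp add: m_assoc)
    finally show ?case
      using t by blast
  qed
  \<comment> \<open>With \<open>p \<otimes> c = \<Delta> [^] m\<close> and
    \<open>s \<otimes> t = \<Delta>\<close>, moving \<open>t\<close> across
    \<open>\<Delta> [^] m\<close> produces the factor \<open>q\<close> that completes
    \<open>s \<otimes> p \<otimes> c\<close> to the next power.\<close>
  have cofinal_pos: "\<exists>m::nat. \<exists>c \<in> P. p \<otimes> c = \<Delta> [^] m" if "p \<in> P" for p
    using that
  proof (induction rule: pos_induct)
    case one
    show ?case
      by (rule exI[of _ 0]) (auto intro: bexI[of _ \<one>])
  next
    case (mult s p)
    then obtain m :: nat and c where c: "c \<in> P" "p \<otimes> c = \<Delta> [^] m"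
      by blast
    obtain t where t: "t \<in> left_divisors G P \<Delta>" "s \<otimes> t = \<Delta>"
      using simple_complements(1)[OF mult(1)] by blast
    have P: "s \<in> P" "t \<in> P"
      using mult t simple_pos by auto
    obtain q where q: "q \<in> P" "t \<otimes> \<Delta> [^] m = \<Delta> [^] m \<otimes> q"
      using right_pow P by blast
    have "s \<otimes> p \<otimes> (c \<otimes> q) = s \<otimes> (p \<otimes> c) \<otimes> q"
      using P c(1) q mult(2) by (simp add: m_assoc)
    also have "\<dots> = s \<otimes> (t \<otimes> \<Delta> [^] m)"
      using P c(2) q by (simp add: m_assoc)
    also have "\<dots> = \<Delta> [^] Suc m"
      using P t(2) nat_pow_Suc2[of \<Delta> m] by (simp add: m_assoc[symmetric])
    finally show ?case
      using c q by (intro exI[of _ "Suc m"] bexI[of _ "c \<otimes> q"]) auto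
  qed
  \<comment> \<open>For a fraction \<open>inv a \<otimes> b\<close>, the power reached from
    \<open>b\<close> also absorbs the denominator:
    \<open>\<Delta> [^] m \<otimes> q = a \<otimes> \<Delta> [^] m\<close>.\<close>
  have cofinal: "\<exists>m::nat. le_left G P g (\<Delta> [^] m)" if g: "g \<in> carrier G" for g
  proof -
    obtain a b where ab: "a \<in> P" "b \<in> P" "g = inv a \<otimes> b"
      using g fractions by auto
    obtain m :: nat and c where c: "c \<in> P" "b \<otimes> c = \<Delta> [^] m"
      using cofinal_pos ab by blast
    obtain q where q: "q \<in> P" "a \<otimes> \<Delta> [^] m = \<Delta> [^] m \<otimes> q"
      using right_pow ab by blast
    have "g \<otimes> (c \<otimes> q) = inv a \<otimes> (b \<otimes> c \<otimes> q)"
      using ab c(1) q(1) by (simp add: m_assoc)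
    also have "b \<otimes> c \<otimes> q = a \<otimes> \<Delta> [^] m"
      using c(2) q(2) by simp
    also have "inv a \<otimes> (a \<otimes> \<Delta> [^] m) = \<Delta> [^] m"
      using ab by (simp add: m_assoc[symmetric])
    finally show ?thesis
      using c q unfolding le_left_def by (intro exI[of _ m] bexI[of _ "c \<otimes> q"]) auto
  qed
  \<comment> \<open>Cofinality for \<open>inv g\<close> makes
    \<open>g \<otimes> \<Delta> [^] m\<close> positive; the power is then moved from the right of
    \<open>g\<close> to its left.\<close>
  have shift_pos: "\<exists>m::nat. \<Delta> [^] m \<otimes> g \<in> P" if g: "g \<in> carrier G" for g
  proof -
    obtain m :: nat and c where c: "c \<in> P" "inv g \<otimes> c = \<Delta> [^] m"
      using cofinal[of "inv g"] g unfolding le_left_def by auto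
    have gc: "g \<otimes> \<Delta> [^] m = c"
      using c(1) g by (simp flip: c(2) add: m_assoc[symmetric])
    have left_pow: "\<exists>q \<in> P. \<Delta> [^] k \<otimes> p = q \<otimes> \<Delta> [^] k" if "p \<in> P" for p and k :: nat
      using that
    proof (induction k arbitrary: p)
      case 0
      then show ?case
        by auto
    next
      case (Suc k)
      obtain q where q: "q \<in> P" "\<Delta> \<otimes> p = q \<otimes> \<Delta>"
        using left Suc.prems by blast
      obtain t where t: "t \<in> P" "\<Delta> [^] k \<otimes> q = t \<otimes> \<Delta> [^] k"
        using Suc.IH q by blast
      have "\<Delta> [^] Suc k \<otimes> p = \<Delta> [^] k \<otimes> q \<otimes> \<Delta>"
        using q Suc.prems by (simp add: m_assoc)
      also have "\<dots> = t \<otimes> \<Delta> [^] Suc k"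
        using q t by (simp add: m_assoc)
      finally show ?case
        using t by blast
    qed
    obtain q where q: "q \<in> P" "\<Delta> [^] m \<otimes> c = q \<otimes> \<Delta> [^] m"
      using left_pow c by blast
    have "\<Delta> [^] m \<otimes> g \<otimes> \<Delta> [^] m = q \<otimes> \<Delta> [^] m"
      using gc q g by (simp add: m_assoc)
    then have "\<Delta> [^] m \<otimes> g = q"
      using q g by simp
    then show ?thesis
      using q by blast
  qed
  have le_left_mult: "le_left G P (c \<otimes> x) (c \<otimes> y) \<longleftrightarrow> le_left G P x y"
    if "c \<in> carrier G" "x \<in> carrier G" "y \<in> carrier G" for c x y
    using that unfolding le_left_def by (simp add: m_assoc cong: bex_cong)
  have glb_pos: "\<exists>m \<in> P. le_left G P m x \<and> le_left G P m y \<and>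
      (\<forall>z \<in> P. le_left G P z x \<longrightarrow> le_left G P z y \<longrightarrow> le_left G P z m)"
    if "x \<in> P" "y \<in> P" for x y
    using L.inf_of_two_exists[of x y] that by (auto simp: order greatest_def Lower_def)
  have shift_pos_mono: "\<Delta> [^] (m + k) \<otimes> g \<in> P" if "\<Delta> [^] m \<otimes> g \<in> P" "g \<in> carrier G"
    for m k :: nat and g
  proof -
    have "\<Delta> [^] (m + k) \<otimes> g = \<Delta> [^] k \<otimes> (\<Delta> [^] m \<otimes> g)"
      using that by (simp add: m_assoc[symmetric] nat_pow_mult add.commute)
    then show ?thesis
      using that by simp
  qed
  text \<open>Left translation by \<open>\<Delta>\<^sup>k\<close> preserves the greatest common divisors of the monoid, so these are
    also greatest lower bounds among all elements of the group.\<close>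
  have glb: "\<exists>m \<in> carrier G. le_left G P m x \<and> le_left G P m y \<and>
      (\<forall>z \<in> carrier G. le_left G P z x \<longrightarrow> le_left G P z y \<longrightarrow> le_left G P z m)"
    if x: "x \<in> carrier G" and y: "y \<in> carrier G" for x y
  proof -
    obtain i j :: nat where "\<Delta> [^] i \<otimes> x \<in> P" "\<Delta> [^] j \<otimes> y \<in> P"
      using shift_pos x y by meson
    then have xy: "\<Delta> [^] (i + j) \<otimes> x \<in> P" "\<Delta> [^] (i + j) \<otimes> y \<in> P"
      using shift_pos_mono[of i x j] shift_pos_mono[of j y i] x y by (auto simp: add.commute)
    \<comment> \<open>\<open>E\<close> clears the denominators of \<open>x\<close> and
      \<open>y\<close> at once.\<close>
    define E where "E = \<Delta> [^] (i + j)"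
    have E: "E \<in> P" "E \<in> carrier G"
      by (auto simp: E_def)
    obtain m where m: "m \<in> P" "le_left G P m (E \<otimes> x)" "le_left G P m (E \<otimes> y)"
      and gr: "\<And>z. \<lbrakk>z \<in> P; le_left G P z (E \<otimes> x); le_left G P z (E \<otimes> y)\<rbrakk> \<Longrightarrow> le_left G P z m"
      using glb_pos[OF xy] unfolding E_def by blast
    define u where "u = inv E \<otimes> m"
    have u: "u \<in> carrier G" "m = E \<otimes> u"
      using m E by (auto simp: u_def m_assoc[symmetric])
    have "le_left G P z u" if z: "z \<in> carrier G" "le_left G P z x" "le_left G P z y" for z
    proof -
      obtain k :: nat where "\<Delta> [^] k \<otimes> (E \<otimes> z) \<in> P"
        using shift_pos[of "E \<otimes> z"] z E by auto
      \<comment> \<open>\<open>F\<close> clears the denominator left in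
        \<open>E \<otimes> z\<close>. The divisor \<open>w\<close> found after this second
        translation is a multiple \<open>F \<otimes> v\<close>, and \<open>v\<close> divides
        \<open>m\<close>, so \<open>E \<otimes> z\<close> lies below \<open>m\<close> too.\<close>
      define F where "F = \<Delta> [^] k"
      have F: "F \<in> P" "F \<in> carrier G"
        by (auto simp: F_def)
      have Fz: "F \<otimes> (E \<otimes> z) \<in> P"
        using \<open>\<Delta> [^] k \<otimes> (E \<otimes> z) \<in> P\<close> by (simp add: F_def)
      have "F \<otimes> (E \<otimes> x) \<in> P" "F \<otimes> (E \<otimes> y) \<in> P"
        using F xy by (auto simp: E_def)
      then obtain w where w: "w \<in> P" "le_left G P w (F \<otimes> (E \<otimes> x))" "le_left G P w (F \<otimes> (E \<otimes> y))"
        and wgr: "\<And>v. \<lbrakk>v \<in> P; le_left G P v (F \<otimes> (E \<otimes> x)); le_left G P v (F \<otimes> (E \<otimes> y))\<rbrakk>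
          \<Longrightarrow> le_left G P v w"
        using glb_pos by blast
      have "le_left G P F (F \<otimes> (E \<otimes> x))" "le_left G P F (F \<otimes> (E \<otimes> y))"
        using xy unfolding le_left_def E_def by auto
      then obtain v where v: "v \<in> P" "w = F \<otimes> v"
        using wgr[OF F(1)] unfolding le_left_def by blast
      have "le_left G P v (E \<otimes> x)" "le_left G P v (E \<otimes> y)"
        using w(2,3) v F E x y le_left_mult by auto
      then have vm: "le_left G P v m"
        using gr v by blast
      have "le_left G P (F \<otimes> (E \<otimes> z)) w"
        using Fz z F E x y le_left_mult by (intro wgr) auto
      then have "le_left G P (E \<otimes> z) v"
        using v F E z le_left_mult by auto
      then have "le_left G P (E \<otimes> z) m"
        using vm E z unfolding le_left_def by (metis m_assoc m_closed mult pos)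
      then show ?thesis
        using u E z le_left_mult by auto
    qed
    moreover have "le_left G P u x" "le_left G P u y"
      using m(2,3) u E x y le_left_mult by auto
    ultimately show ?thesis
      using u by blast
  qed
  have units: "a = \<one>" if "a \<in> P" "b \<in> P" "a \<otimes> b = \<one>" for a b
  proof -
    have "le_left G P a \<one>" "le_left G P \<one> a"
      using that unfolding le_left_def by auto
    then show ?thesis
      using L.le_antisym[of a \<one>] that by (simp add: order)
  qed
  show ?thesis
  proof (intro quasi_garside_group.intro quasi_garside_group_axioms.intro)
    show "submonoid P G" "\<Delta> \<in> P"
      by (simp_all add: positive_submonoid)
    show "finite {p \<in> P. le_left G P p (\<Delta> [^] m)}" for m :: nat
      by (rule finite_left_divisors) simp
  qed (fact group_axioms units right left glb cofinal)+
qed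

end

section \<open>The group \<open>G(n)\<close>\<close>

lemma shift_const:
  assumes "1 \<le> n"
  shows "shift n l (\<lambda>i \<in> {1..n}. c) = (\<lambda>i \<in> {1..n}. c)"
  using shift_index[OF assms] by (auto simp: shift_def fun_eq_iff simp del: atLeastAtMost_iff)

lemma shift_in_PiE:
  assumes "u \<in> {1..n} \<rightarrow>\<^sub>E A"
  shows "shift n l u \<in> {1..n} \<rightarrow>\<^sub>E A"
proof
  fix i assume i: "i \<in> {1..n}"
  then have "nat ((int i - 1 - l) mod int n) + 1 \<in> {1..n}"
    by (intro shift_index) simp
  then have "u (nat ((int i - 1 - l) mod int n) + 1) \<in> A"
    using assms by blast
  then show "shift n l u i \<in> A"
    using i by (simp add: shift_def)
qed (auto simp: shift_def)

lemma shift_inverse: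
  assumes "u \<in> {1..n} \<rightarrow>\<^sub>E A"
  shows "shift n l (shift n (- l) u) = u" "shift n (- l) (shift n l u) = u"
  using assms by (auto simp: shift_shift shift_zero PiE_def)

text \<open>A shift permutes the indices; the converse direction shifts back by
  \<open>- l\<close>.\<close>

lemma ball_shift_iff:
  assumes "u \<in> {1..n} \<rightarrow>\<^sub>E A" "v \<in> {1..n} \<rightarrow>\<^sub>E B"
  shows "(\<forall>i \<in> {1..n}. Q (shift n l u i) (shift n l v i)) \<longleftrightarrow> (\<forall>i \<in> {1..n}. Q (u i) (v i))"
proof -
  have *: "\<forall>i \<in> {1..n}. Q (shift n k x i) (shift n k y i)" if "\<forall>i \<in> {1..n}. Q (x i) (y i)" for k x y
  proof
    fix i assume i: "i \<in> {1..n}"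
    then have "nat ((int i - 1 - k) mod int n) + 1 \<in> {1..n}"
      by (intro shift_index) simp
    then show "Q (shift n k x i) (shift n k y i)"
      using that i by (simp add: shift_def)
  qed
  show ?thesis
    using *[of u v l] *[of "shift n l u" "shift n l v" "- l"] shift_inverse[OF assms(1)]
      shift_inverse[OF assms(2)] by auto
qed

lemma carrier_wreath: "carrier (wreath G n) = UNIV \<times> ({1..n} \<rightarrow>\<^sub>E carrier G)"
  by (simp add: wreath_def)

lemma mult_wreath:
  "(k, u) \<otimes>\<^bsub>wreath G n\<^esub> (l, v) = (k + l, \<lambda>i \<in> {1..n}. shift n l u i \<otimes>\<^bsub>G\<^esub> v i)"
  by (simp add: wreath_def)

lemma one_wreath: "\<one>\<^bsub>wreath G n\<^esub> = (0, \<lambda>i \<in> {1..n}. \<one>\<^bsub>G\<^esub>)"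
  by (simp add: wreath_def)

lemma shift_one_fixed_imp_const:
  assumes u: "u \<in> {1..n} \<rightarrow>\<^sub>E A" and fixed: "shift n 1 u = u"
  shows "u = (\<lambda>i \<in> {1..n}. u 1)"
proof
  fix i
  have "u i = u 1" if "1 \<le> i" "i \<le> n"
    using that
  proof (induction i rule: nat_induct_at_least)
    case (Suc i)
    then show ?case
      using fun_cong[OF fixed, of "Suc i"] by (simp add: shift_one)
  qed simp
  then show "u i = (\<lambda>i \<in> {1..n}. u 1) i"
    using u by (auto simp: PiE_iff extensional_def)
qed

context quasi_garside_group
begin

lemma PiE_pos: "u \<in> {1..n} \<rightarrow>\<^sub>E P \<Longrightarrow> u \<in> {1..n} \<rightarrow>\<^sub>E carrier G"
  by (auto simp: PiE_iff)

text \<open>A quotient must have exponent \<open>l - k\<close>, and multiplying by it shifts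
  \<open>u\<close> by that amount; its entries can then be found one index at a time.\<close>

lemma wreath_le_iff_shift:
  assumes u: "u \<in> {1..n} \<rightarrow>\<^sub>E carrier G" and v: "v \<in> {1..n} \<rightarrow>\<^sub>E carrier G"
  shows "le_left (wreath G n) (wreath_pos P n) (k, u) (l, v) \<longleftrightarrow>
    k \<le> l \<and> (\<forall>i \<in> {1..n}. shift n (l - k) u i \<preceq> v i)"
proof
  assume "le_left (wreath G n) (wreath_pos P n) (k, u) (l, v)"
  then obtain j c where "0 \<le> j" "c \<in> {1..n} \<rightarrow>\<^sub>E P" "(k, u) \<otimes>\<^bsub>wreath G n\<^esub> (j, c) = (l, v)"
    by (auto simp: le_left_def wreath_pos_def)
  then show "k \<le> l \<and> (\<forall>i \<in> {1..n}. shift n (l - k) u i \<preceq> v i)"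
    by (auto simp: mult_wreath le_left_def PiE_iff)
next
  assume le: "k \<le> l \<and> (\<forall>i \<in> {1..n}. shift n (l - k) u i \<preceq> v i)"
  then have "\<forall>i \<in> {1..n}. \<exists>c \<in> P. shift n (l - k) u i \<otimes> c = v i"
    by (simp add: le_left_def)
  then obtain c where c: "\<forall>i \<in> {1..n}. c i \<in> P \<and> shift n (l - k) u i \<otimes> c i = v i"
    by metis
  have "(k, u) \<otimes>\<^bsub>wreath G n\<^esub> (l - k, restrict c {1..n}) = (l, v)"
    using c v by (auto simp: mult_wreath fun_eq_iff PiE_iff extensional_def)
  moreover have "(l - k, restrict c {1..n}) \<in> wreath_pos P n"
    using le c by (auto simp: wreath_pos_def)
  ultimately show "le_left (wreath G n) (wreath_pos P n) (k, u) (l, v)"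
    unfolding le_left_def by blast
qed

text \<open>Writing \<open>\<delta>\<^sup>k u\<close> as \<open>u' \<delta>\<^sup>k\<close> turns the order of \<open>G(n)\<close> into a product order.\<close>

lemma wreath_le_iff:
  assumes u: "u \<in> {1..n} \<rightarrow>\<^sub>E carrier G" and v: "v \<in> {1..n} \<rightarrow>\<^sub>E carrier G"
  shows "le_left (wreath G n) (wreath_pos P n) (k, u) (l, v) \<longleftrightarrow>
    k \<le> l \<and> (\<forall>i \<in> {1..n}. shift n (- k) u i \<preceq> shift n (- l) v i)"
proof -
  have "(\<forall>i \<in> {1..n}. shift n (- l) (shift n (l - k) u) i \<preceq> shift n (- l) v i) \<longleftrightarrow>
      (\<forall>i \<in> {1..n}. shift n (l - k) u i \<preceq> v i)"
    by (rule ball_shift_iff[OF shift_in_PiE[OF u] v])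
  then show ?thesis
    using wreath_le_iff_shift[OF u v] by (simp add: shift_shift)
qed

lemma wreath_Delta_pow:
  assumes n: "1 \<le> n"
  shows "wreath_Delta \<Delta> n [^]\<^bsub>wreath G n\<^esub> (m::nat) = (int m, \<lambda>i \<in> {1..n}. \<Delta> [^] m)"
proof -
  interpret W: group "wreath G n"
    by (rule group_wreath) unfold_locales
  show ?thesis
  proof (induction m)
    case 0
    then show ?case
      by (simp add: one_wreath fun_eq_iff)
  next
    case (Suc m)
    show ?case
      unfolding W.nat_pow_Suc Suc
      unfolding wreath_Delta_def mult_wreath shift_const[OF n]
      by (auto intro!: restrict_ext)
  qed
qed

lemma le_Delta_nat_pow_mono:
  assumes "x \<preceq> \<Delta> [^] (k::nat)" "k \<le> m" "x \<in> carrier G"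
  shows "x \<preceq> \<Delta> [^] m"
  using le_trans[OF assms(1) _ assms(3)] Delta_pow_mono[of "int k" "int m"] assms(2)
  by (simp add: int_pow_int)

lemma wreath_submonoid:
  assumes n: "1 \<le> n"
  shows "submonoid (wreath_pos P n) (wreath G n)"
proof
  show "wreath_pos P n \<subseteq> carrier (wreath G n)"
    by (auto simp: wreath_pos_def carrier_wreath PiE_iff)
  show "x \<otimes>\<^bsub>wreath G n\<^esub> y \<in> wreath_pos P n" if xy: "x \<in> wreath_pos P n" "y \<in> wreath_pos P n" for x y
  proof -
    obtain k u l v where e: "x = (k, u)" "y = (l, v)"
      by (cases x, cases y)
    have "0 \<le> k" "0 \<le> l" and uv: "u \<in> {1..n} \<rightarrow>\<^sub>E P" "v \<in> {1..n} \<rightarrow>\<^sub>E P"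
      using xy e by (auto simp: wreath_pos_def)
    then show ?thesis
      using shift_in_PiE[OF uv(1), of l] by (auto simp: e mult_wreath wreath_pos_def PiE_iff)
  qed
  show "\<one>\<^bsub>wreath G n\<^esub> \<in> wreath_pos P n"
    by (auto simp: one_wreath wreath_pos_def)
qed

text \<open>In the coordinates of \<open>wreath_le_iff\<close> the order is a product order, so the
  bound has exponent \<open>min k l\<close> and entrywise meets \<open>w\<close>; shifting by
  \<open>min k l\<close> returns to the stored form.\<close>

lemma wreath_glb_exists:
  assumes x: "x \<in> carrier (wreath G n)" and y: "y \<in> carrier (wreath G n)"
  shows "\<exists>m \<in> carrier (wreath G n).
    le_left (wreath G n) (wreath_pos P n) m x \<and> le_left (wreath G n) (wreath_pos P n) m y \<and>
    (\<forall>z \<in> carrier (wreath G n). le_left (wreath G n) (wreath_pos P n) z x \<longrightarrow>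
       le_left (wreath G n) (wreath_pos P n) z y \<longrightarrow> le_left (wreath G n) (wreath_pos P n) z m)"
proof -
  obtain k u l v where e: "x = (k, u)" "y = (l, v)"
    by (cases x, cases y)
  have uv: "u \<in> {1..n} \<rightarrow>\<^sub>E carrier G" "v \<in> {1..n} \<rightarrow>\<^sub>E carrier G"
    using x y e by (auto simp: carrier_wreath)
  define w where "w = (\<lambda>i \<in> {1..n}. shift n (- k) u i \<curlywedge> shift n (- l) v i)"
  define m where "m = shift n (min k l) w"
  have su: "shift n (- k) u i \<in> carrier G" "shift n (- l) v i \<in> carrier G" if "i \<in> {1..n}" for i
    using PiE_mem[OF shift_in_PiE[OF uv(1)] that] PiE_mem[OF shift_in_PiE[OF uv(2)] that] by auto
  have w: "w \<in> {1..n} \<rightarrow>\<^sub>E carrier G"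
    using su by (auto simp: w_def)
  then have m: "m \<in> {1..n} \<rightarrow>\<^sub>E carrier G"
    unfolding m_def by (rule shift_in_PiE)
  have mw: "shift n (- min k l) m = w"
    unfolding m_def by (rule shift_inverse[OF w])
  show ?thesis
  proof (intro bexI conjI ballI impI)
    show "(min k l, m) \<in> carrier (wreath G n)"
      using m by (simp add: carrier_wreath)
    show "le_left (wreath G n) (wreath_pos P n) (min k l, m) x"
      using su meet_le1 unfolding e wreath_le_iff[OF m uv(1)] mw by (auto simp: w_def)
    show "le_left (wreath G n) (wreath_pos P n) (min k l, m) y"
      using su meet_le2 unfolding e wreath_le_iff[OF m uv(2)] mw by (auto simp: w_def)
    fix z assume z: "z \<in> carrier (wreath G n)"
      and zx: "le_left (wreath G n) (wreath_pos P n) z x"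
      and zy: "le_left (wreath G n) (wreath_pos P n) z y"
    obtain j t where zt: "z = (j, t)"
      by (cases z)
    have t: "t \<in> {1..n} \<rightarrow>\<^sub>E carrier G"
      using z zt by (simp add: carrier_wreath)
    have st: "shift n (- j) t i \<in> carrier G" if "i \<in> {1..n}" for i
      using PiE_mem[OF shift_in_PiE[OF t] that] .
    show "le_left (wreath G n) (wreath_pos P n) z (min k l, m)"
      using zx zy su st meet_greatest
      unfolding e zt wreath_le_iff[OF t uv(1)] wreath_le_iff[OF t uv(2)] wreath_le_iff[OF t m] mw
      by (auto simp: w_def)
  qed
qed

lemma wreath_Delta_cofinal:
  assumes n: "1 \<le> n" and x: "x \<in> carrier (wreath G n)"
  shows "\<exists>m::nat. le_left (wreath G n) (wreath_pos P n) x (wreath_Delta \<Delta> n [^]\<^bsub>wreath G n\<^esub> m)"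
proof -
  obtain k u where e: "x = (k, u)"
    by (cases x)
  have u: "u \<in> {1..n} \<rightarrow>\<^sub>E carrier G"
    using x e by (simp add: carrier_wreath)
  have su: "shift n (- k) u i \<in> carrier G" if "i \<in> {1..n}" for i
    using PiE_mem[OF shift_in_PiE[OF u] that] .
  have "\<forall>i \<in> {1..n}. \<exists>m::nat. shift n (- k) u i \<preceq> \<Delta> [^] m"
    using su Delta_cofinal by blast
  then obtain f :: "nat \<Rightarrow> nat" where f: "\<forall>i \<in> {1..n}. shift n (- k) u i \<preceq> \<Delta> [^] f i"
    by metis
  \<comment> \<open>The sum dominates each \<open>f i\<close>, and \<open>nat k\<close> takes care
    of the exponent of \<delta>.\<close>
  define m where "m = nat k + (\<Sum>i \<in> {1..n}. f i)"
  have le: "f i \<le> m" if "i \<in> {1..n}" for i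
    using member_le_sum[of i "{1..n}" f] that by (simp add: m_def)
  have c: "(\<lambda>i \<in> {1..n}. \<Delta> [^] m) \<in> {1..n} \<rightarrow>\<^sub>E carrier G"
    by auto
  have "shift n (- k) u i \<preceq> \<Delta> [^] m" if "i \<in> {1..n}" for i
    using f le su that le_Delta_nat_pow_mono by blast
  moreover have "k \<le> int (nat k)"
    by simp
  then have "k \<le> int m"
    unfolding m_def by linarith
  ultimately have "le_left (wreath G n) (wreath_pos P n) (k, u) (int m, \<lambda>i \<in> {1..n}. \<Delta> [^] m)"
    unfolding wreath_le_iff[OF u c] shift_const[OF n] by simp
  then show ?thesis
    unfolding wreath_Delta_pow[OF n] e by blast
qed

text \<open>In the product coordinates a divisor has exponent between 0 and \<open>m\<close> and
  entries dividing \<open>\<Delta> [^] m\<close>.\<close>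

lemma wreath_finite_divisors:
  assumes n: "1 \<le> n"
  shows "finite {p \<in> wreath_pos P n.
    le_left (wreath G n) (wreath_pos P n) p (wreath_Delta \<Delta> n [^]\<^bsub>wreath G n\<^esub> (m::nat))}" (is "finite ?S")
proof -
  let ?D = "{p \<in> P. p \<preceq> \<Delta> [^] m}"
  have c: "(\<lambda>i \<in> {1..n}. \<Delta> [^] m) \<in> {1..n} \<rightarrow>\<^sub>E carrier G"
    by auto
  have "?S \<subseteq> (\<lambda>(k, w). (k, shift n k w)) ` ({0..int m} \<times> ({1..n} \<rightarrow>\<^sub>E ?D))"
  proof
    fix p assume p: "p \<in> ?S"
    obtain k u where e: "p = (k, u)"
      by (cases p)
    have u: "u \<in> {1..n} \<rightarrow>\<^sub>E P" and k: "0 \<le> k"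
      using p e by (auto simp: wreath_pos_def)
    have "k \<le> int m" and le: "\<forall>i \<in> {1..n}. shift n (- k) u i \<preceq> (\<lambda>i \<in> {1..n}. \<Delta> [^] m) i"
      using p unfolding e wreath_Delta_pow[OF n] mem_Collect_eq wreath_le_iff[OF PiE_pos[OF u] c]
        shift_const[OF n] by blast+
    moreover have "shift n (- k) u \<in> {1..n} \<rightarrow>\<^sub>E ?D"
      using le shift_in_PiE[OF u, of "- k"] by (auto simp: PiE_iff)
    moreover have "p = (k, shift n k (shift n (- k) u))"
      using shift_inverse[OF u] e by simp
    ultimately show "p \<in> (\<lambda>(k, w). (k, shift n k w)) ` ({0..int m} \<times> ({1..n} \<rightarrow>\<^sub>E ?D))"
      using k by force
  qed
  moreover have "finite ({0..int m} \<times> ({1..n} \<rightarrow>\<^sub>E ?D))"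
    using finite_divisors_Delta_pow by (intro finite_cartesian_product finite_PiE) auto
  ultimately show ?thesis
    using finite_subset finite_imageI by blast
qed

lemma wreath_Delta_right:
  assumes n: "1 \<le> n" and p: "p \<in> wreath_pos P n"
  shows "\<exists>q \<in> wreath_pos P n.
    p \<otimes>\<^bsub>wreath G n\<^esub> wreath_Delta \<Delta> n = wreath_Delta \<Delta> n \<otimes>\<^bsub>wreath G n\<^esub> q"
proof -
  obtain k u where e: "p = (k, u)"
    by (cases p)
  have u: "u \<in> {1..n} \<rightarrow>\<^sub>E P" and k: "0 \<le> k"
    using p e by (auto simp: wreath_pos_def)
  have "\<forall>i \<in> {1..n}. \<exists>q \<in> P. shift n 1 u i \<otimes> \<Delta> = \<Delta> \<otimes> q"
    using shift_in_PiE[OF u, of 1] Delta_right by (auto simp: PiE_iff)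
  then obtain q where q: "\<forall>i \<in> {1..n}. q i \<in> P \<and> shift n 1 u i \<otimes> \<Delta> = \<Delta> \<otimes> q i"
    by metis
  show ?thesis
  proof
    show "(k, restrict q {1..n}) \<in> wreath_pos P n"
      using q k by (auto simp: wreath_pos_def)
    show "p \<otimes>\<^bsub>wreath G n\<^esub> wreath_Delta \<Delta> n
        = wreath_Delta \<Delta> n \<otimes>\<^bsub>wreath G n\<^esub> (k, restrict q {1..n})"
      using q by (auto simp: e wreath_Delta_def mult_wreath shift_const[OF n] fun_eq_iff
          simp del: One_nat_def)
  qed
qed

lemma wreath_Delta_left:
  assumes n: "1 \<le> n" and p: "p \<in> wreath_pos P n"
  shows "\<exists>q \<in> wreath_pos P n.
    wreath_Delta \<Delta> n \<otimes>\<^bsub>wreath G n\<^esub> p = q \<otimes>\<^bsub>wreath G n\<^esub> wreath_Delta \<Delta> n"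
proof -
  obtain k u where e: "p = (k, u)"
    by (cases p)
  have u: "u \<in> {1..n} \<rightarrow>\<^sub>E P" and k: "0 \<le> k"
    using p e by (auto simp: wreath_pos_def)
  have "\<forall>i \<in> {1..n}. \<exists>q \<in> P. \<Delta> \<otimes> u i = q \<otimes> \<Delta>"
    using u Delta_left by (auto simp: PiE_iff)
  then obtain q where q: "\<forall>i \<in> {1..n}. q i \<in> P \<and> \<Delta> \<otimes> u i = q i \<otimes> \<Delta>"
    by metis
  define r where "r = restrict q {1..n}"
  have r: "r \<in> {1..n} \<rightarrow>\<^sub>E P"
    using q by (auto simp: r_def)
  show ?thesis
  proof
    \<comment> \<open>The shift by -1 cancels the shift caused by multiplying with
      \<open>wreath_Delta\<close> on the right.\<close>
    show "(k, shift n (- 1) r) \<in> wreath_pos P n"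
      using shift_in_PiE[OF r] k by (simp add: wreath_pos_def)
    show "wreath_Delta \<Delta> n \<otimes>\<^bsub>wreath G n\<^esub> p
        = (k, shift n (- 1) r) \<otimes>\<^bsub>wreath G n\<^esub> wreath_Delta \<Delta> n"
      using q shift_inverse(1)[OF r, of 1]
      by (auto simp: e wreath_Delta_def mult_wreath shift_const[OF n] fun_eq_iff r_def
          simp del: One_nat_def)
  qed
qed

lemma wreath_no_units:
  assumes p: "p \<in> wreath_pos P n" and q: "q \<in> wreath_pos P n"
    and pq: "p \<otimes>\<^bsub>wreath G n\<^esub> q = \<one>\<^bsub>wreath G n\<^esub>"
  shows "p = \<one>\<^bsub>wreath G n\<^esub>"
proof -
  obtain k u l v where e: "p = (k, u)" "q = (l, v)"
    by (cases p, cases q)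
  have u: "u \<in> {1..n} \<rightarrow>\<^sub>E P" and v: "v \<in> {1..n} \<rightarrow>\<^sub>E P" and "0 \<le> k" "0 \<le> l"
    using p q e by (auto simp: wreath_pos_def)
  then have kl: "k = 0" "l = 0"
    using pq by (auto simp: e mult_wreath one_wreath)
  have eq: "(\<lambda>i \<in> {1..n}. u i \<otimes> v i) = (\<lambda>i \<in> {1..n}. \<one>)"
    using pq kl u by (simp add: e mult_wreath one_wreath shift_zero PiE_def)
  have "u i = \<one>" if i: "i \<in> {1..n}" for i
  proof -
    have "u i \<otimes> v i = \<one>"
      using fun_cong[OF eq, of i] i by simp
    moreover have "u i \<in> P" "v i \<in> P"
      using u v i by auto
    ultimately show ?thesis
      using pos_no_units by blast
  qed
  then have "u = (\<lambda>i \<in> {1..n}. \<one>)"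
    using u by (auto simp: fun_eq_iff PiE_iff extensional_def)
  then show ?thesis
    using e kl by (simp add: one_wreath)
qed

text \<open>The exponent of \<delta> is additive, nonnegative on positive elements and 1 on the
  Garside element, so \<open>fst\<close> serves as the degree.\<close>

lemma wreath_graded_garside:
  assumes n: "1 \<le> n"
  shows "graded_garside_group (wreath G n) (wreath_pos P n) (wreath_Delta \<Delta> n) fst"
proof -
  interpret W: group "wreath G n"
    by (rule group_wreath) unfold_locales
  show ?thesis
  proof (intro graded_garside_group.intro graded_garside_group_axioms.intro
      quasi_garside_group.intro quasi_garside_group_axioms.intro)
    show "submonoid (wreath_pos P n) (wreath G n)"
      by (rule wreath_submonoid[OF n])
    show "wreath_Delta \<Delta> n \<in> wreath_pos P n"
      using Delta_pos by (auto simp: wreath_Delta_def wreath_pos_def)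
    show "fst (x \<otimes>\<^bsub>wreath G n\<^esub> y) = fst x + fst y" for x y
      by (cases x, cases y) (simp add: mult_wreath)
    show "0 \<le> fst p" if "p \<in> wreath_pos P n" for p
      using that by (auto simp: wreath_pos_def)
    show "fst (wreath_Delta \<Delta> n) = 1"
      by (simp add: wreath_Delta_def)
  qed (fact W.group_axioms wreath_no_units wreath_Delta_right[OF n] wreath_Delta_left[OF n] wreath_glb_exists
      wreath_Delta_cofinal[OF n] wreath_finite_divisors[OF n])+
qed

end

section \<open>Conjugacy to diagonal elements and roots\<close>

context group
begin

text \<open>Compare entries: on the left the shift moves \<open>x n\<close> to index 1 and
  \<open>x i\<close> to index \<open>Suc i\<close>. Index 1, where \<open>g\<close> sits, gives the
  first equation, and the rest are reindexed by \<open>Suc\<close>.\<close>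

lemma wreath_diagonal_commute_iff:
  assumes n: "1 \<le> n" and g: "g \<in> carrier G" and x: "x \<in> {1..n} \<rightarrow>\<^sub>E carrier G"
  shows "(k, x) \<otimes>\<^bsub>wreath G n\<^esub> (1, \<lambda>i \<in> {1..n}. if i = 1 then g else \<one>)
      = (1, \<lambda>i \<in> {1..n}. h) \<otimes>\<^bsub>wreath G n\<^esub> (k, x) \<longleftrightarrow>
    x n \<otimes> g = h \<otimes> x 1 \<and> (\<forall>i \<in> {1..<n}. x i = h \<otimes> x (Suc i))"
proof -
  let ?y = "\<lambda>i. if i = 1 then x n else x (i - 1)"
  have "(k, x) \<otimes>\<^bsub>wreath G n\<^esub> (1, \<lambda>i \<in> {1..n}. if i = 1 then g else \<one>)
      = (1, \<lambda>i \<in> {1..n}. h) \<otimes>\<^bsub>wreath G n\<^esub> (k, x) \<longleftrightarrow>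
    (\<forall>i \<in> {1..n}. ?y i \<otimes> (if i = 1 then g else \<one>) = h \<otimes> x i)"
    unfolding mult_wreath shift_const[OF n] shift_one prod.inject restrict_eq_iff
    by (simp add: add.commute restrict_apply' del: atLeastAtMost_iff restrict_apply One_nat_def cong: ball_cong)
  also have "\<dots> \<longleftrightarrow> (\<forall>i \<in> insert 1 (Suc ` {1..<n}). ?y i \<otimes> (if i = 1 then g else \<one>) = h \<otimes> x i)"
  proof -
    have "{1..n} = insert 1 (Suc ` {1..<n})"
      using n by (auto simp: image_Suc_atLeastLessThan)
    then show ?thesis
      by simp
  qed
  also have "\<dots> \<longleftrightarrow> x n \<otimes> g = h \<otimes> x 1 \<and> (\<forall>i \<in> {1..<n}. x i \<otimes> \<one> = h \<otimes> x (Suc i))"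
    by (auto simp del: image_Suc_atLeastLessThan)
  also have "\<dots> \<longleftrightarrow> x n \<otimes> g = h \<otimes> x 1 \<and> (\<forall>i \<in> {1..<n}. x i = h \<otimes> x (Suc i))"
  proof -
    have "x i \<otimes> \<one> = x i" if "i \<in> {1..<n}" for i
      using x that by (intro r_one) auto
    then show ?thesis
      by auto
  qed
  finally show ?thesis .
qed

text \<open>The recursion telescopes from index \<open>n\<close> down to 1, and the equation at
  index 1 closes the cycle as \<open>x n \<otimes> g = h [^] n \<otimes> x n\<close>.\<close>

lemma nth_root_of_wreath_conjugate:
  assumes n: "1 \<le> n" and g: "g \<in> carrier G" and h: "h \<in> carrier G"
    and x: "x \<in> {1..n} \<rightarrow>\<^sub>E carrier G"
    and eq: "(1, \<lambda>i \<in> {1..n}. if i = 1 then g else \<one>)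
      = inv\<^bsub>wreath G n\<^esub> (k, x) \<otimes>\<^bsub>wreath G n\<^esub> (1, \<lambda>i \<in> {1..n}. h) \<otimes>\<^bsub>wreath G n\<^esub> (k, x)"
  shows "g = (inv (x n) \<otimes> h \<otimes> x n) [^] n"
proof -
  interpret W: group "wreath G n"
    by (rule group_wreath) unfold_locales
  have "(k, x) \<otimes>\<^bsub>wreath G n\<^esub> (1, \<lambda>i \<in> {1..n}. if i = 1 then g else \<one>)
      = (1, \<lambda>i \<in> {1..n}. h) \<otimes>\<^bsub>wreath G n\<^esub> (k, x)"
    using eq by (rule W.eq_conj_iff[THEN iffD1, rotated 3]) (use x g h in \<open>auto simp: carrier_wreath\<close>)
  then have xg: "x n \<otimes> g = h \<otimes> x 1" and step: "\<And>i. i \<in> {1..<n} \<Longrightarrow> x i = h \<otimes> x (Suc i)"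
    using wreath_diagonal_commute_iff[OF n g x] by auto
  have xn: "x n \<in> carrier G"
    using x n by auto
  have pow: "x (n - j) = h [^] j \<otimes> x n" if "j < n" for j
    using that
  proof (induction j)
    case (Suc j)
    then have "x (n - Suc j) = h \<otimes> x (n - j)"
      using step[of "n - Suc j"] by (simp add: Suc_diff_Suc)
    also have "\<dots> = h [^] Suc j \<otimes> x n"
      using Suc h xn nat_pow_Suc2[OF h, of j] by (simp add: m_assoc)
    finally show ?case .
  qed (use xn in simp)
  have "x n \<otimes> g = h \<otimes> (h [^] (n - 1) \<otimes> x n)"
    using xg pow[of "n - 1"] n by simp
  also have "\<dots> = h [^] n \<otimes> x n"
    using h xn n nat_pow_Suc2[OF h, of "n - 1"] by (simp add: m_assoc)
  finally have "g = inv (x n) \<otimes> h [^] n \<otimes> x n"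
    using eq_conj_iff[OF xn g nat_pow_closed[OF h]] by simp
  then show ?thesis
    using conj_nat_pow[OF xn h] by simp
qed

text \<open>The entries of \<open>x\<close> solve the recursion of
  \<open>wreath_diagonal_commute_iff\<close> starting from \<open>x n = \<one>\<close>.\<close>

lemma wreath_conjugate_of_nth_root:
  assumes n: "1 \<le> n" and f: "f \<in> carrier G"
  defines "x \<equiv> (\<lambda>i \<in> {1..n}. f [^] (n - i))"
  shows "(1, \<lambda>i \<in> {1..n}. if i = 1 then f [^] n else \<one>)
      = inv\<^bsub>wreath G n\<^esub> (0, x) \<otimes>\<^bsub>wreath G n\<^esub> (1, \<lambda>i \<in> {1..n}. f) \<otimes>\<^bsub>wreath G n\<^esub> (0, x)"
proof -
  interpret W: group "wreath G n"
    by (rule group_wreath) unfold_locales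
  have x: "x \<in> {1..n} \<rightarrow>\<^sub>E carrier G"
    using f by (auto simp: x_def)
  have "x n \<otimes> f [^] n = f \<otimes> x 1"
    using n f nat_pow_Suc2[OF f, of "n - 1"] by (simp add: x_def)
  moreover have "x i = f \<otimes> x (Suc i)" if "i \<in> {1..<n}" for i
    using that nat_pow_Suc2[OF f, of "n - Suc i"] by (simp add: x_def Suc_diff_Suc)
  ultimately have "(0, x) \<otimes>\<^bsub>wreath G n\<^esub> (1, \<lambda>i \<in> {1..n}. if i = 1 then f [^] n else \<one>)
      = (1, \<lambda>i \<in> {1..n}. f) \<otimes>\<^bsub>wreath G n\<^esub> (0, x)"
    using wreath_diagonal_commute_iff[OF n nat_pow_closed[OF f] x] by blast
  then show ?thesis
    by (rule W.eq_conj_iff[THEN iffD2, rotated 3]) (use x f in \<open>auto simp: carrier_wreath\<close>)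
qed

end

context quasi_garside_group
begin

text \<open>Conjugation by \<delta> or its inverse only shifts the tuple, so it preserves positivity
  and fixes the constant tuple of the Garside element.\<close>

lemma wreath_generator_normalizer:
  assumes n: "1 \<le> n"
  shows "(1, \<lambda>i \<in> {1..n}. \<one>)
    \<in> quasi_garside_group.order_normalizer (wreath G n) (wreath_pos P n) (wreath_Delta \<Delta> n)"
proof -
  interpret W: graded_garside_group "wreath G n" "wreath_pos P n" "wreath_Delta \<Delta> n" fst
    by (rule wreath_graded_garside[OF n])
  define z where "z = (1::int, \<lambda>i \<in> {1..n}. \<one>)"
  have zc: "z \<in> carrier (wreath G n)"
    by (auto simp: z_def carrier_wreath)
  have z_left: "z \<otimes>\<^bsub>wreath G n\<^esub> (k, u) = (k + 1, u)" if "u \<in> {1..n} \<rightarrow>\<^sub>E carrier G" for k u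
    using that unfolding z_def mult_wreath shift_const[OF n]
    by (auto simp: fun_eq_iff PiE_iff extensional_def)
  have z_right: "(k, u) \<otimes>\<^bsub>wreath G n\<^esub> z = (k + 1, shift n 1 u)"
    if "u \<in> {1..n} \<rightarrow>\<^sub>E carrier G" for k u
    using shift_in_PiE[OF that, of 1] unfolding z_def mult_wreath
    by (auto simp: fun_eq_iff PiE_iff extensional_def)
  have "z \<otimes>\<^bsub>wreath G n\<^esub> p \<otimes>\<^bsub>wreath G n\<^esub> inv\<^bsub>wreath G n\<^esub> z \<in> wreath_pos P n
      \<and> inv\<^bsub>wreath G n\<^esub> z \<otimes>\<^bsub>wreath G n\<^esub> p \<otimes>\<^bsub>wreath G n\<^esub> z \<in> wreath_pos P n"
    if p: "p \<in> wreath_pos P n" for p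
  proof -
    obtain k u where e: "p = (k, u)"
      by (cases p)
    have u: "u \<in> {1..n} \<rightarrow>\<^sub>E P" and k: "0 \<le> k"
      using p e by (auto simp: wreath_pos_def)
    have q: "(k, shift n l u) \<in> wreath_pos P n" for l
      using shift_in_PiE[OF u] k by (simp add: wreath_pos_def)
    have pc: "p \<in> carrier (wreath G n)"
      using p by (rule W.pos_carrier)
    have "z \<otimes>\<^bsub>wreath G n\<^esub> p = (k, shift n (- 1) u) \<otimes>\<^bsub>wreath G n\<^esub> z"
      using z_left[OF PiE_pos[OF u]] z_right[OF PiE_pos[OF shift_in_PiE[OF u]]] shift_inverse(1)[OF u, of 1]
      by (simp add: e)
    then have 1: "z \<otimes>\<^bsub>wreath G n\<^esub> p \<otimes>\<^bsub>wreath G n\<^esub> inv\<^bsub>wreath G n\<^esub> z = (k, shift n (- 1) u)"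
      using zc pc W.pos_carrier[OF q] by (simp add: W.m_assoc)
    have "p \<otimes>\<^bsub>wreath G n\<^esub> z = z \<otimes>\<^bsub>wreath G n\<^esub> (k, shift n 1 u)"
      using z_right[OF PiE_pos[OF u]] z_left[OF PiE_pos[OF shift_in_PiE[OF u]]]
      by (simp add: e)
    then have 2: "inv\<^bsub>wreath G n\<^esub> z \<otimes>\<^bsub>wreath G n\<^esub> p \<otimes>\<^bsub>wreath G n\<^esub> z = (k, shift n 1 u)"
      using zc pc W.pos_carrier[OF q, of 1] by (simp add: W.m_assoc) (simp add: W.m_assoc[symmetric])
    show ?thesis
      unfolding 1 2 using q by blast
  qed
  moreover have "z \<otimes>\<^bsub>wreath G n\<^esub> wreath_Delta \<Delta> n = wreath_Delta \<Delta> n \<otimes>\<^bsub>wreath G n\<^esub> z"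
    unfolding wreath_Delta_def using z_left[of "\<lambda>i \<in> {1..n}. \<Delta>" 1] z_right[of "\<lambda>i \<in> {1..n}. \<Delta>" 1]
    by (simp add: shift_const[OF n] del: One_nat_def)
  ultimately show ?thesis
    using zc unfolding W.order_normalizer_def z_def by blast
qed

text \<open>An ultra summit element commuting with \<delta> exists. Its exponent is 1 because
  conjugation keeps the degree, and commuting with \<delta> makes its tuple shift-invariant, hence
  constant.\<close>

lemma wreath_ultra_summit_diagonal:
  assumes n: "1 \<le> n" and f: "f \<in> carrier G"
  shows "\<exists>h \<in> carrier G. (1, \<lambda>i \<in> {1..n}. h)
    \<in> ultra_summit_set (wreath G n) (wreath_pos P n) (wreath_Delta \<Delta> n) (1, \<lambda>i \<in> {1..n}. f)"
proof -
  interpret W: graded_garside_group "wreath G n" "wreath_pos P n" "wreath_Delta \<Delta> n" fst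
    by (rule wreath_graded_garside[OF n])
  define z where "z = (1::int, \<lambda>i \<in> {1..n}. \<one>)"
  define a where "a = (1::int, \<lambda>i \<in> {1..n}. f)"
  have zc: "z \<in> carrier (wreath G n)" and ac: "a \<in> carrier (wreath G n)"
    using f by (auto simp: z_def a_def carrier_wreath)
  have "z \<otimes>\<^bsub>wreath G n\<^esub> a = a \<otimes>\<^bsub>wreath G n\<^esub> z"
    unfolding z_def a_def mult_wreath shift_const[OF n] using f by (auto simp: fun_eq_iff)
  then obtain b where b: "b \<in> ultra_summit_set (wreath G n) (wreath_pos P n) (wreath_Delta \<Delta> n) a"
    and zb: "z \<otimes>\<^bsub>wreath G n\<^esub> b = b \<otimes>\<^bsub>wreath G n\<^esub> z"
    using W.ex_ultra_summit_commuting[OF wreath_generator_normalizer[OF n] ac]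
    unfolding z_def by blast
  have "b \<in> conj_class (wreath G n) a"
    using b by (simp add: ultra_summit_set_def super_summit_set_def)
  then have bc: "b \<in> carrier (wreath G n)" and "fst b = 1"
    using W.conj_class_carrier[OF _ ac] W.deg_conj_class[OF _ ac] by (auto simp: a_def)
  then obtain u where bu: "b = (1, u)" and u: "u \<in> {1..n} \<rightarrow>\<^sub>E carrier G"
    by (cases b) (auto simp: carrier_wreath)
  have "(\<lambda>i \<in> {1..n}. \<one> \<otimes> u i) = (\<lambda>i \<in> {1..n}. shift n 1 u i \<otimes> \<one>)"
    using zb unfolding z_def bu mult_wreath shift_const[OF n] prod.inject restrict_eq_iff
    by (simp add: restrict_apply' del: atLeastAtMost_iff restrict_apply One_nat_def)
  moreover have "(\<lambda>i \<in> {1..n}. \<one> \<otimes> u i) = u"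
    using u by (auto simp: fun_eq_iff PiE_iff extensional_def)
  moreover have "(\<lambda>i \<in> {1..n}. shift n 1 u i \<otimes> \<one>) = shift n 1 u"
    using shift_in_PiE[OF u, of 1] by (auto simp: fun_eq_iff PiE_iff extensional_def)
  ultimately have "u = (\<lambda>i \<in> {1..n}. u 1)"
    by (intro shift_one_fixed_imp_const[OF u]) simp
  moreover have "u 1 \<in> carrier G"
    using u n by auto
  ultimately show ?thesis
    using b bu unfolding a_def by metis
qed

end

theorem theorem8p2:
  fixes G :: "('a, 'b) monoid_scheme" (structure)
    and P :: "'a set" and \<Delta> g :: 'a and n :: nat
  assumes "garside_group G P \<Delta>"
    and "g \<in> carrier G"
    and "1 \<le> n"
  shows "((\<exists>f \<in> carrier G. f [^] n = g) \<longleftrightarrow>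
          (\<exists>h \<in> carrier G. (1, \<lambda>i \<in> {1..n}. h)
             \<in> ultra_summit_set (wreath G n) (wreath_pos P n) (wreath_Delta \<Delta> n)
                 (1, \<lambda>i \<in> {1..n}. if i = 1 then g else \<one>)))
       \<and> ((\<exists>f \<in> carrier G. f [^] n = g) \<longrightarrow>
          (\<forall>h \<in> carrier G. \<forall>k :: int. \<forall>x \<in> {1..n} \<rightarrow>\<^sub>E carrier G.
             (1, \<lambda>i \<in> {1..n}. if i = 1 then g else \<one>)
               = inv\<^bsub>wreath G n\<^esub> (k, x) \<otimes>\<^bsub>wreath G n\<^esub> (1, \<lambda>i \<in> {1..n}. h) \<otimes>\<^bsub>wreath G n\<^esub> (k, x)
             \<longrightarrow> g = (inv (x n) \<otimes> h \<otimes> x n) [^] n))"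
proof -
  interpret quasi_garside_group G P \<Delta>
    using assms(1) by (rule garside_group.quasi_garside)
  interpret W: group "wreath G n"
    by (rule group_wreath) unfold_locales
  note g = assms(2) and n = assms(3)
  let ?g = "(1::int, \<lambda>i \<in> {1..n}. if i = 1 then g else \<one>)"
  let ?d = "\<lambda>h. (1::int, \<lambda>i \<in> {1..n}. h)"
  let ?U = "ultra_summit_set (wreath G n) (wreath_pos P n) (wreath_Delta \<Delta> n)"
  have gc: "?g \<in> carrier (wreath G n)"
    using g by (auto simp: carrier_wreath)
  have dc: "?d h \<in> carrier (wreath G n)" if "h \<in> carrier G" for h
    using that by (auto simp: carrier_wreath)
  have "\<exists>h \<in> carrier G. ?d h \<in> ?U ?g" if f: "f \<in> carrier G" "f [^] n = g" for f
  proof -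
    let ?x = "(0::int, \<lambda>i \<in> {1..n}. f [^] (n - i))"
    have xc: "?x \<in> carrier (wreath G n)"
      using f by (auto simp: carrier_wreath)
    \<comment> \<open>A root \<open>f\<close> makes \<open>?g\<close> conjugate to
      \<open>?d f\<close>, so both have the same ultra summit set.\<close>
    have "conj_class (wreath G n) ?g = conj_class (wreath G n) (?d f)"
      using wreath_conjugate_of_nth_root[OF n f(1), unfolded f(2)] W.conj_class_conj[OF xc dc[OF f(1)]]
      by (simp only:)
    then show ?thesis
      using wreath_ultra_summit_diagonal[OF n f(1)] ultra_summit_set_cong by metis
  qed
  moreover have "\<exists>f \<in> carrier G. f [^] n = g" if h: "h \<in> carrier G" "?d h \<in> ?U ?g" for h
  proof -
    obtain y where y: "y \<in> carrier (wreath G n)"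
      "?d h = inv\<^bsub>wreath G n\<^esub> y \<otimes>\<^bsub>wreath G n\<^esub> ?g \<otimes>\<^bsub>wreath G n\<^esub> y"
      using h(2) by (auto simp: ultra_summit_set_def super_summit_set_def conj_class_def)
    \<comment> \<open>Membership gives \<open>?d h\<close> as a conjugate of \<open>?g\<close> by
      \<open>y\<close>; the opposite relation has conjugator \<open>inv y\<close>, whose components
      are named here.\<close>
    obtain k x where kx: "inv\<^bsub>wreath G n\<^esub> y = (k, x)"
      by (cases "inv\<^bsub>wreath G n\<^esub> y")
    then have x: "x \<in> {1..n} \<rightarrow>\<^sub>E carrier G"
      using W.inv_closed[OF y(1)] by (simp add: carrier_wreath)
    have "?g = inv\<^bsub>wreath G n\<^esub> (k, x) \<otimes>\<^bsub>wreath G n\<^esub> ?d h \<otimes>\<^bsub>wreath G n\<^esub> (k, x)"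
      unfolding kx[symmetric] y(2) W.inv_inv[OF y(1)]
      using y(1) gc by (simp add: W.m_assoc) (simp add: W.m_assoc[symmetric])
    then have "g = (inv (x n) \<otimes> h \<otimes> x n) [^] n"
      by (rule nth_root_of_wreath_conjugate[OF n g h(1) x])
    moreover have "x n \<in> carrier G"
      using x n by auto
    ultimately show ?thesis
      using h(1) by (intro bexI[of _ "inv (x n) \<otimes> h \<otimes> x n"]) auto
  qed
  ultimately show ?thesis
    using nth_root_of_wreath_conjugate[OF n g] by blast
qed

end
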